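(* For every real exponent $\alpha>1$ the mapping $p_3(p_4)$ is in the Pick Argument Lessening class $P$. That is, the quantity $p_3$, regarded as a function of the quantity $p_4$ via the correspondence $p_4(a)\mapsto p_3(a)$, $a\in(0,1)$, is (the restriction of) a function in $P$: there is $\varphi\in P$ with $\varphi(p_4(a))=p_3(a)$ for all $a\in(0,1)$.
   Context: Fix a real $\alpha>1$. For a real parameter $a\in(0,1)$ let $f_a(x)=-|x|^{\alpha}+a$ for $x\in\mathbb{R}$, and let $f_a^{n}$ denote the $n$-th iterate, with $f_a^0(0)=0$. For $n\ge 3$ define $$p_n=p_n(a)=\frac{f_a^{n-3}(0)-f_a^{n}(0)}{f_a^{n-3}(0)-f_a^{n-1}(0)}\cdot\frac{f_a^{n-1}(0)-f_a^{n-2}(0)}{f_a^{n}(0)-f_a^{n-2}(0)}.$$ In particular $$p_3(a)=\frac{f_a^{3}(0)}{f_a^{2}(0)}\cdot\frac{f_a^{2}(0)-f_a(0)}{f_a^{3}(0)-f_a(0)},\qquad p_4(a)=\frac{f_a(0)-f_a^{4}(0)}{f_a(0)-f_a^{3}(0)}\cdot\frac{f_a^{3}(0)-f_a^{2}(0)}{f_a^{4}(0)-f_a^{2}(0)}.$$ Let $\mathbf{H}=\{z\in\mathbb{C}:\operatorname{Im} z>0\}$. The class $P$ of Pick Argument Lessening functions consists of all functions $\varphi$ analytic in $\mathbf{H}$ such that: (i) $\operatorname{Im}\varphi(z)>0$ for all $z\in\mathbf{H}$; (ii) $\varphi$ can be analytically continued by (Schwarz) reflection through the half-axis $(1,+\infty)$,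 so that $\varphi$ is defined, analytic and real-valued on $(1,+\infty)$; (iii) $\varphi$ fixes $1$, i.e. $\varphi$ extends continuously along the reals to $1$ with $\varphi(1)=\lim_{x\to1^+}\varphi(x)=1$. *)

theory Defs
  imports "HOL-Complex_Analysis.Complex_Analysis"
begin

definition fmap :: "real \<Rightarrow> real \<Rightarrow> real \<Rightarrow> real" where
  "fmap \<alpha> a x = - (\<bar>x\<bar> powr \<alpha>) + a"

definition orb :: "real \<Rightarrow> real \<Rightarrow> nat \<Rightarrow> real" where
  "orb \<alpha> a n = (fmap \<alpha> a ^^ n) 0"

text \<open>Only meaningful for \<open>n \<ge> 3\<close>, since \<open>n - 3\<close> is truncated subtraction.\<close>

definition pr :: "real \<Rightarrow> nat \<Rightarrow> real \<Rightarrow> real" where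
  "pr \<alpha> n a =
     (orb \<alpha> a (n - 3) - orb \<alpha> a n) / (orb \<alpha> a (n - 3) - orb \<alpha> a (n - 1)) *
     ((orb \<alpha> a (n - 1) - orb \<alpha> a (n - 2)) / (orb \<alpha> a n - orb \<alpha> a (n - 2)))"

definition upper_half_plane :: "complex set" where
  "upper_half_plane = {z. Im z > 0}"

text \<open>The domain obtained from the upper half-plane by reflection through
  \<open>(1, \<infinity>)\<close>: upper and lower half-planes together with \<open>(1, \<infinity>)\<close>.\<close>

definition reflected_domain :: "complex set" where
  "reflected_domain =
     upper_half_plane \<union> complex_of_real ` {1<..} \<union> cnj ` upper_half_plane"

text \<open>The Pick Argument Lessening class. A member is represented by its continuation:
  a total function whose relevant values are those on \<open>reflected_domain\<close>, where it is
  analytic and symmetric under Schwarz reflection, together with the boundary value at \<open>1\<close>.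
  Other values are unconstrained.\<close>

definition PAL :: "(complex \<Rightarrow> complex) set" where
  "PAL = {\<phi>.
     (\<forall>z\<in>upper_half_plane. Im (\<phi> z) > 0) \<and>
     \<phi> analytic_on reflected_domain \<and>
     (\<forall>z\<in>reflected_domain. \<phi> (cnj z) = cnj (\<phi> z)) \<and>
     (\<forall>x::real. x > 1 \<longrightarrow> \<phi> (of_real x) \<in> \<real>) \<and>
     \<phi> 1 = 1 \<and> ((\<lambda>x::real. \<phi> (of_real x)) \<longlongrightarrow> 1) (at_right 1)}"

end

theory Submission
  imports Defs
begin

text \<open>Put \<open>b = 1/\<alpha>\<close>. Dividing the orbit of \<open>0\<close> by its first point \<open>a\<close> and writing
  \<open>X = u powr (-\<alpha>)\<close>, where \<open>a u\<close> is the second point, turns the two quantities into functions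
  of the single variable \<open>X\<close>, which runs through \<open>(1, \<infinity>)\<close> as \<open>a\<close> runs through \<open>(0, 1)\<close>:
  \<open>p\<^sub>3 = Q X\<close> and \<open>p\<^sub>4 = Z X\<close>, with \<open>Q X = 1 + X^b (X - 1)\<close>, \<open>Z X = (X - 1)/(Y X - 1)\<close>
  and \<open>Y X = X^(1+\<alpha>) (Q X)^(-\<alpha>)\<close>. These formulas make sense for complex \<open>X\<close>. The function
  required is \<open>Q\<close> composed with an inverse of \<open>Z\<close>: it is enough to find a region \<open>U\<close> of the
  upper half-plane \<open>H\<close> on which \<open>Q\<close> has values in \<open>H\<close> and which \<open>Z\<close> maps
  bijectively onto \<open>H\<close>, in such a way that the inverse extends continuously to the boundary
  piece \<open>(1, \<infinity>)\<close> with real values there. The Schwarz reflection principle does the rest.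

  The region is \<open>U = {X \<in> H. Q X \<in> H, |arg (Y X)| < \<pi>, Z X \<in> H}\<close>. A proper holomorphic map into
  a connected set is bijective as soon as it takes one value exactly once, at a regular point
  (\<open>proper_holomorphic_bij_betw\<close>), so the work lies in proving that \<open>Z\<close> is proper on \<open>U\<close>: if
  \<open>X\<^sub>n \<in> U\<close> and \<open>Z X\<^sub>n\<close> converges in \<open>H\<close>, then \<open>X\<^sub>n\<close> cannot escape from \<open>U\<close>
  (\<open>U_limit_cases\<close>). Escape to \<open>\<infinity>\<close>, to a root of \<open>Q\<close>, or to the half-axis \<open>[0, \<infinity>)\<close> forces the
  limit of \<open>Z X\<^sub>n\<close> to be infinite, zero or real, and near the negative half-axis \<open>Q\<close> is not
  in \<open>H\<close>. Where \<open>Y\<close> becomes negative, \<open>Z\<close> lies in the lower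
  half-plane at once; this is why the bound on \<open>arg Y\<close> can be imposed, and it keeps all the
  logarithms on one branch even when \<open>\<alpha>\<close> is large. There remains the curve on which \<open>Q\<close> is
  real. With \<open>\<theta> = arg X\<close> it is given by \<open>|X| = sin (b \<theta>) / sin ((1 + b) \<theta>)\<close>, and the assertion
  that \<open>Z\<close> is in the lower half-plane there (\<open>Im_Z_neg_on_critical_curve\<close>) is an inequality
  between powers of sines. The inequality \<open>x powr b \<le> 1 - b + b x\<close> removes the powers, and what
  is left is the concavity of the sine on \<open>[0, \<pi>]\<close>, applied twice
  (\<open>sine_inequality_outer\<close>, \<open>sine_inequality_inner\<close>).

  The same compactness argument, with a limit \<open>\<zeta> > 1\<close> in place of a limit in \<open>H\<close>, gives the
  continuous extension to \<open>(1, \<infinity>)\<close>, provided that \<open>Z\<close> has no value in \<open>(1, \<infinity>)\<close> at a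
  point of \<open>H\<close> with \<open>|arg (Y X)| < \<pi>\<close> (\<open>Z_not_real_gt_1\<close>). For such a point \<open>X\<close> the numbers \<open>X\<close> and \<open>Y X\<close> would lie
  on one ray from \<open>1\<close>, while \<open>X = h X / h (Y X)\<close> with \<open>h x = 1 - x^(-b)\<close>. The argument of \<open>h\<close>
  decreases along rays from \<open>1\<close> into \<open>H\<close>, so the quotient has negative imaginary part, a contradiction.
  Finally, on \<open>(1, \<infinity>)\<close> the function \<open>Z\<close> is strictly increasing, by convexity of
  \<open>x powr (1 + b)\<close>; this identifies the boundary values and supplies the simple value.\<close>

section \<open>Inequalities between sines\<close>

text \<open>The mean value theorem on both sides of the intermediate point compares two values of the
  cosine, which is strictly decreasing on \<open>[0, \<pi>]\<close>.\<close>

lemma sin_strictly_concave: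
  fixes x y t :: real
  assumes "0 \<le> x" "x < y" "y \<le> pi" "0 < t" "t < 1"
  shows "(1 - t) * sin x + t * sin y < sin ((1 - t) * x + t * y)"
proof -
  define m where "m = (1 - t) * x + t * y"
  have m1: "m - x = t * (y - x)" and m2: "y - m = (1 - t) * (y - x)"
    by (auto simp: m_def algebra_simps)
  have xm: "x < m" "m < y"
    using m1 m2 assms by (smt (verit) mult_pos_pos)+
  obtain c1 where c1: "x < c1" "c1 < m" "sin m - sin x = (m - x) * cos c1"
    using MVT2[OF xm(1), of sin cos] by auto
  obtain c2 where c2: "m < c2" "c2 < y" "sin y - sin m = (y - m) * cos c2"
    using MVT2[OF xm(2), of sin cos] by auto
  have "cos c2 < cos c1"
    by (rule cos_monotone_0_pi) (use c1 c2 assms in auto)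
  hence "t * (1 - t) * (y - x) * cos c2 < t * (1 - t) * (y - x) * cos c1"
    using assms by (intro mult_strict_left_mono) auto
  moreover have "(1 - t) * (sin m - sin x) = t * (1 - t) * (y - x) * cos c1"
    unfolding c1 m1 by simp
  moreover have "t * (sin y - sin m) = t * (1 - t) * (y - x) * cos c2"
    unfolding c2 m2 by simp
  ultimately show ?thesis
    unfolding m_def[symmetric] by (simp add: algebra_simps)
qed

lemma powr_le_chord:
  fixes x b :: real
  assumes "0 < x" "0 < b" "b < 1"
  shows "x powr b \<le> 1 - b + b * x"
  using Youngs_inequality_0[of b "1 - b" x 1] assms by simp

text \<open>The part of the critical curve on which \<open>Q > 0\<close>, in the variable \<open>B = \<theta>/\<alpha>\<close>. At \<open>\<alpha> = 1\<close> both
  sides agree, so only estimates that are exact there can work. After the powers have been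
  replaced by their chords and the denominator \<open>S (1 + \<alpha>)\<close> has been cleared, the claim is
  quadratic in the values of \<open>S\<close>. It follows from the identity
  \<open>S (1 + \<alpha>)^2 = S \<alpha>^2 + S 1 * S (1 + 2 \<alpha>)\<close> and from the two instances of concavity
  in which \<open>1 + 2 \<alpha>\<close> lies between \<open>1 + \<alpha>\<close> and \<open>1 + \<alpha> + \<alpha>^2\<close>, and \<open>\<alpha>\<close> between \<open>1\<close> and \<open>1 + \<alpha>\<close>.\<close>

lemma sine_inequality_outer:
  fixes \<alpha> B :: real
  assumes a: "\<alpha> > 1" and B: "B > 0" and *: "(1 + \<alpha> + \<alpha>\<^sup>2) * B < pi"
  defines "S \<equiv> \<lambda>c. sin (c * B)" and "b \<equiv> 1 / \<alpha>"
  shows "(S 1 / S (1 + \<alpha>)) powr b * S \<alpha>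
      + S 1 * (S (1 + \<alpha> + \<alpha>\<^sup>2) / S (1 + \<alpha>)) powr b < S (1 + \<alpha>)"
proof -
  have a2: "\<alpha> < \<alpha>\<^sup>2" using a by (simp add: power2_eq_square)
  have b: "0 < b" "b < 1" "b * \<alpha> = 1" "b * \<alpha>\<^sup>2 = \<alpha>"
    using a by (auto simp: b_def power2_eq_square)
  have lt: "c * B < pi" if "c \<le> 1 + \<alpha> + \<alpha>\<^sup>2" for c
    proof -
    have "c * B \<le> (1 + \<alpha> + \<alpha>\<^sup>2) * B" using that B by (intro mult_right_mono) auto
    thus ?thesis using * by linarith
  qed
  have pos: "S c > 0" if "0 < c" "c \<le> 1 + \<alpha> + \<alpha>\<^sup>2" for c
    unfolding S_def using lt[OF that(2)] that B by (intro sin_gt_zero) auto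
  define A t where "A = S (1 + \<alpha>)" and "t = S (1 + \<alpha> + \<alpha>\<^sup>2)"
  have p: "A > 0" "t > 0" "S 1 > 0" "S \<alpha> > 0"
    unfolding A_def t_def using a a2 by (auto intro!: pos)
  have conc: "(1 - b) * S c + b * S d < S ((1 - b) * c + b * d)"
    if "0 \<le> c" "c < d" "d \<le> 1 + \<alpha> + \<alpha>\<^sup>2" for c d
    using sin_strictly_concave[of "c * B" "d * B" b] lt[OF that(3)] that B b
    by (simp add: S_def algebra_simps)
  have c1: "(1 - b) * A + b * t < S (1 + 2 * \<alpha>)"
    using conc[of "1 + \<alpha>" "1 + \<alpha> + \<alpha>\<^sup>2"] a a2 b
    by (simp add: A_def t_def algebra_simps)
  have c2: "b * S 1 + (1 - b) * A < S \<alpha>"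
  proof -
    have "(1 - (1 - b)) * sin (1 * B) + (1 - b) * sin ((1 + \<alpha>) * B)
        < sin ((1 - (1 - b)) * (1 * B) + (1 - b) * ((1 + \<alpha>) * B))"
      using lt[of "1 + \<alpha>"] a a2 b B by (intro sin_strictly_concave) auto
    also have "(1 - (1 - b)) * (1 * B) + (1 - b) * ((1 + \<alpha>) * B) = (\<alpha> + 1 - b * \<alpha>) * B"
      by (simp add: algebra_simps)
    finally show ?thesis using b by (simp add: S_def A_def)
  qed
  have quad: "A\<^sup>2 = (S \<alpha>)\<^sup>2 + S 1 * S (1 + 2 * \<alpha>)"
  proof -
    have "S (1 + 2 * \<alpha>) = sin (\<alpha> * B + (1 + \<alpha>) * B)"
      by (simp add: S_def algebra_simps)
    moreover have "S 1 = sin ((1 + \<alpha>) * B - \<alpha> * B)"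
      by (simp add: S_def algebra_simps)
    ultimately have "S 1 * S (1 + 2 * \<alpha>)
       = (sin ((1 + \<alpha>) * B))\<^sup>2 * (cos (\<alpha> * B))\<^sup>2 - (sin (\<alpha> * B))\<^sup>2 * (cos ((1 + \<alpha>) * B))\<^sup>2"
      by (simp only: sin_diff sin_add) (simp add: algebra_simps power2_eq_square)
    also have "\<dots> = A\<^sup>2 - (S \<alpha>)\<^sup>2"
      by (simp add: A_def S_def cos_squared_eq algebra_simps)
    finally show ?thesis by simp
  qed
  have "(S 1 / A) powr b * S \<alpha> + S 1 * (t / A) powr b
      \<le> (1 - b + b * (S 1 / A)) * S \<alpha> + S 1 * (1 - b + b * (t / A))"
    using p b by (intro add_mono mult_right_mono mult_left_mono powr_le_chord) auto
  also have "\<dots> < A"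
  proof -
    have "((1 - b) * S \<alpha> + (1 - b) * S 1) * A + S 1 * (b * S \<alpha> + b * t) < A\<^sup>2"
    proof -
      have "S 1 * (b * t) < S 1 * (S (1 + 2 * \<alpha>) - (1 - b) * A)"
        using c1 p by (intro mult_strict_left_mono) auto
      moreover have "(b * S 1 + (1 - b) * A) * S \<alpha> < S \<alpha> * S \<alpha>"
        using c2 p by (intro mult_strict_right_mono) auto
      ultimately show ?thesis
        using quad by (simp add: algebra_simps power2_eq_square)
    qed
    moreover have "(1 - b + b * (S 1 / A)) * S \<alpha> + S 1 * (1 - b + b * (t / A))
       = (((1 - b) * S \<alpha> + (1 - b) * S 1) * A + S 1 * (b * S \<alpha> + b * t)) / A"
      using p by (simp add: field_simps)
    ultimately show ?thesis
      using p by (simp add: pos_divide_less_eq power2_eq_square)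
  qed
  finally show ?thesis unfolding A_def t_def .
qed

text \<open>The part of the critical curve on which \<open>Q < 0\<close>; here \<open>d\<close> is \<open>\<pi> - arg X - B\<close>. Again the
  powers are replaced by their chords, and concavity is used for \<open>B - d\<close> between \<open>B - \<alpha> d\<close>
  and \<open>B\<close>, and for \<open>2 B\<close> between \<open>B\<close> and \<open>(1 + \<alpha>) B\<close>. The two combine through
  \<open>sin (B + d) - sin (B - d) = 2 cos B sin d\<close>.\<close>

lemma sine_inequality_inner:
  fixes \<alpha> B d :: real
  assumes a: "\<alpha> > 1" and d: "d > 0" and dB: "\<alpha> * d < B" and sum: "(1 + \<alpha>) * B + d = pi"
  defines "b \<equiv> 1 / \<alpha>"
  shows "sin d * (sin d / sin B) powr b + sin B * (sin (B - \<alpha> * d) / sin B) powr b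
      < sin (B + d)"
proof -
  have b: "0 < b" "b < 1" "b * \<alpha> = 1" using a by (auto simp: b_def)
  have "0 < \<alpha> * d" using a d by simp
  hence B: "B > 0" using dB by linarith
  have aB: "B < \<alpha> * B" using a B by simp
  have "(1 + \<alpha>) * B = B + \<alpha> * B" by (simp add: algebra_simps)
  hence lt: "B < pi" "(1 + \<alpha>) * B < pi" and dpi: "d < pi"
    using sum d aB B by linarith+
  define A s where "A = sin d" and "s = sin (B - \<alpha> * d)"
  have p: "A > 0" "s > 0" "sin B > 0"
    unfolding A_def s_def using B d dB lt dpi \<open>0 < \<alpha> * d\<close> by (auto intro!: sin_gt_zero)
  have A: "A = sin ((1 + \<alpha>) * B)"
  proof -
    have "d = pi - (1 + \<alpha>) * B" using sum by simp
    thus ?thesis unfolding A_def by simp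
  qed
  have c1: "(1 - b) * sin B + b * s < sin (B - d)"
  proof -
    have "(1 - (1 - b)) * sin (B - \<alpha> * d) + (1 - b) * sin B
        < sin ((1 - (1 - b)) * (B - \<alpha> * d) + (1 - b) * B)"
      using dB lt \<open>0 < \<alpha> * d\<close> b by (intro sin_strictly_concave) auto
    also have "(1 - (1 - b)) * (B - \<alpha> * d) + (1 - b) * B = B - (b * \<alpha>) * d"
      by (simp add: algebra_simps)
    finally show ?thesis using b by (simp add: s_def)
  qed
  have c2: "(1 - b) * sin B + b * A < 2 * sin B * cos B"
  proof -
    have "(1 - b) * sin B + b * sin ((1 + \<alpha>) * B) < sin ((1 - b) * B + b * ((1 + \<alpha>) * B))"
      using B aB lt b by (intro sin_strictly_concave) (auto simp: algebra_simps)
    also have "(1 - b) * B + b * ((1 + \<alpha>) * B) = B + (b * \<alpha>) * B"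
      by (simp add: algebra_simps)
    finally show ?thesis using b by (simp add: A sin_double[symmetric])
  qed
  have "A * (A / sin B) powr b + sin B * (s / sin B) powr b
     \<le> A * (1 - b + b * (A / sin B)) + sin B * (1 - b + b * (s / sin B))"
    using p b by (intro add_mono mult_left_mono powr_le_chord) auto
  also have "\<dots> = A * (((1 - b) * sin B + b * A) / sin B) + ((1 - b) * sin B + b * s)"
    using p by (simp add: field_simps)
  also have "\<dots> < A * (2 * sin B * cos B / sin B) + sin (B - d)"
    using c1 c2 p by (intro add_strict_mono mult_strict_left_mono divide_strict_right_mono) auto
  also have "\<dots> = sin (B + d)"
    using p by (simp add: A_def sin_add sin_diff)
  finally show ?thesis unfolding A_def s_def .
qed

text \<open>Here \<open>r\<close> and \<open>\<theta>\<close> are the polar coordinates of a point \<open>X\<close> at which \<open>Q X\<close> is the real number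
  \<open>q\<close>; then \<open>r powr (1 + \<alpha>) / |q| powr \<alpha>\<close> and \<open>\<eta>\<close> are the polar coordinates of \<open>Y X\<close>. The
  triangles with vertices \<open>0, 1, X\<close> and \<open>0, 1, Y X\<close> express the sign of \<open>Im (Z X)\<close> through their
  angles at \<open>1\<close>, and the law of sines turns this into the stated inequality. If \<open>\<theta> b + \<eta>\<close> is
  outside \<open>(0, \<pi>)\<close>, the left-hand side is not positive. Otherwise the inequality says
  \<open>r * (sin (b \<theta> + \<eta>) / A) powr b < |q|\<close> with \<open>A = sin ((1 + b) \<theta>)\<close>, which is one of the two
  preceding lemmas, according to the sign of \<open>q\<close>.\<close>

lemma critical_curve_sine_bound:
  fixes \<alpha> b \<theta> r q \<eta> :: real
  assumes a: "\<alpha> > 1" and b_def: "b = 1 / \<alpha>" and th: "0 < \<theta>" "(1 + b) * \<theta> < pi"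
    and r: "r * sin ((1 + b) * \<theta>) = sin (b * \<theta>)"
    and q: "q = 1 - r powr b * sin \<theta> / sin ((1 + b) * \<theta>)" "q \<noteq> 0"
    and eta: "\<eta> = (1 + \<alpha>) * \<theta> - \<alpha> * (if q > 0 then 0 else pi)" "\<bar>\<eta>\<bar> < pi"
  shows "r powr (1 + \<alpha>) / \<bar>q\<bar> powr \<alpha> * sin (b * \<theta> + \<eta>) < sin (b * \<theta>)"
proof -
  have b: "0 < b" "b < 1" "b * \<alpha> = 1" using a by (auto simp: b_def)
  define B where "B = b * \<theta>"
  have B: "B > 0" "\<alpha> * B = \<theta>" "(1 + \<alpha>) * B = (1 + b) * \<theta>"
    using b th by (auto simp: B_def algebra_simps)
  have th_pi: "\<theta> < pi" "B < pi" "B < \<theta>"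
  proof -
    have "(1 + b) * \<theta> = \<theta> + B" "b * \<theta> < 1 * \<theta>" unfolding B_def
      using b th by (simp add: algebra_simps, intro mult_strict_right_mono) auto
    thus "\<theta> < pi" "B < pi" "B < \<theta>" using B(1) th(2) unfolding B_def by linarith+
  qed
  define A \<sigma> where "A = sin ((1 + \<alpha>) * B)" and "\<sigma> = sin (B + \<eta>)"
  have p: "A > 0" "sin B > 0" "sin \<theta> > 0"
    unfolding A_def using B(1,3) th th_pi a b by (auto intro!: sin_gt_zero mult_pos_pos)
  have rA: "r = sin B / A" using r p unfolding A_def B(3) B_def[symmetric] by (simp add: field_simps)
  hence r0: "r > 0" using p by simp
  have q': "q = 1 - r powr b * sin \<theta> / A" using q B by (simp add: A_def)
  show ?thesis
  proof (cases "\<sigma> \<le> 0")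
    case True
    have "r powr (1 + \<alpha>) / \<bar>q\<bar> powr \<alpha> * \<sigma> \<le> 0"
      using True by (intro mult_nonneg_nonpos) auto
    thus ?thesis using p by (simp add: \<sigma>_def B_def)
  next
    case False
    hence s: "\<sigma> > 0" by simp
    have range: "0 < B + \<eta>" "B + \<eta> < pi"
    proof -
      have "- pi < B + \<eta>" "B + \<eta> < 2 * pi" using B th_pi eta(2) by auto
      show "0 < B + \<eta>"
      proof (rule ccontr)
        assume "\<not> 0 < B + \<eta>"
        hence "sin (- (B + \<eta>)) \<ge> 0" using \<open>- pi < B + \<eta>\<close> by (intro sin_ge_zero) auto
        thus False using s unfolding \<sigma>_def sin_minus by linarith
      qed
      show "B + \<eta> < pi"
      proof (rule ccontr)
        assume "\<not> B + \<eta> < pi"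
        hence "sin (B + \<eta>) \<le> 0" using \<open>B + \<eta> < 2 * pi\<close> by (intro sin_le_zero) auto
        thus False using s by (simp add: \<sigma>_def)
      qed
    qed
    have key: "r * (\<sigma> / A) powr b < \<bar>q\<bar>"
    proof (cases "q > 0")
      case True
      have e: "B + \<eta> = (1 + \<alpha> + \<alpha>\<^sup>2) * B"
        using eta(1) True B(2)[symmetric] by (simp add: algebra_simps power2_eq_square)
      have "(sin B / A) powr b * sin \<theta> + sin B * (\<sigma> / A) powr b < A"
        using sine_inequality_outer[OF a B(1)] range e B
        by (simp add: A_def \<sigma>_def b_def)
      hence "(r powr b * sin \<theta> + sin B * (\<sigma> / A) powr b) / A < 1"
        using p by (simp add: rA)
      thus ?thesis using True by (simp add: q' rA add_divide_distrib)
    next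
      case False
      hence qn: "q < 0" using q(2) by linarith
      define d where "d = pi - (1 + \<alpha>) * B"
      have d: "d > 0" using th B by (simp add: d_def)
      have e: "\<eta> = - (\<alpha> * d)"
        using eta(1) False B(2)[symmetric] by (simp add: d_def algebra_simps)
      have sd: "sin d = A" by (simp add: d_def A_def)
      have "sin \<theta> = sin (B + d)"
      proof -
        have "B + d = pi - \<theta>" using B by (simp add: d_def algebra_simps)
        thus ?thesis by simp
      qed
      hence "A * (A / sin B) powr b + sin B * (\<sigma> / sin B) powr b < sin \<theta>"
        using sine_inequality_inner[OF a d, of B] range e sd
        by (simp add: d_def \<sigma>_def b_def)
      hence "r powr b / A * (A * (A / sin B) powr b + sin B * (\<sigma> / sin B) powr b)
          < r powr b / A * sin \<theta>"
        using p r0 by (intro mult_strict_left_mono) auto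
      moreover have "r powr b * (A / sin B) powr b = 1"
        using p r0 by (simp add: rA flip: powr_mult)
      moreover have "r powr b * (\<sigma> / sin B) powr b = (\<sigma> / A) powr b"
        using p r0 s by (simp add: rA flip: powr_mult)
      ultimately have "1 + r * (\<sigma> / A) powr b < r powr b * sin \<theta> / A"
        using p by (simp add: rA field_simps)
      thus ?thesis using qn by (simp add: q')
    qed
    have "(r * (\<sigma> / A) powr b) powr \<alpha> < \<bar>q\<bar> powr \<alpha>"
      using key a r0 by (intro powr_less_mono2) auto
    hence "r powr \<alpha> * (\<sigma> / A) < \<bar>q\<bar> powr \<alpha>"
      using r0 s p b by (simp add: powr_mult powr_powr)
    hence "r * A * (r powr \<alpha> * (\<sigma> / A)) < r * A * \<bar>q\<bar> powr \<alpha>"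
      using r0 p by (intro mult_strict_left_mono) auto
    hence "r powr (1 + \<alpha>) * \<sigma> < sin B * \<bar>q\<bar> powr \<alpha>"
      using r0 p by (simp add: powr_add rA)
    thus ?thesis using q(2) by (simp add: \<sigma>_def B_def field_simps)
  qed
qed

text \<open>The inequality expresses that \<open>(x^(1+b) - x)/(x - 1)\<close> has positive imaginary part at
  \<open>x = r e^(i \<phi>)\<close>. Weighted means bound \<open>r powr b\<close> by a combination of \<open>1\<close> and \<open>r powr (1 + b)\<close>,
  with weights \<open>1/(1 + b)\<close> and \<open>b/(1 + b)\<close>; concavity of the sine between \<open>0\<close> and \<open>(1 + b) \<phi>\<close>
  compares the coefficients.\<close>

lemma sine_young:
  fixes r \<phi> b :: real
  assumes r: "r > 0" and phi: "0 < \<phi>" "\<phi> < pi" and b: "0 < b" "b < 1"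
  shows "r powr b * sin ((1 + b) * \<phi>) < r powr (1 + b) * sin (b * \<phi>) + sin \<phi>"
proof -
  have "b * \<phi> < 1 * \<phi>" using b phi by (intro mult_strict_right_mono) auto
  hence "b * \<phi> < pi" using phi by linarith
  moreover have "0 < b * \<phi>" using b phi by simp
  ultimately have bphi: "0 < b * \<phi>" "b * \<phi> < pi" by auto
  hence pos: "sin (b * \<phi>) > 0" "sin \<phi> > 0" using phi sin_gt_zero by auto
  define S where "S = sin ((1 + b) * \<phi>)"
  show ?thesis
  proof (cases "S \<le> 0")
    case True
    hence "r powr b * S \<le> 0" by (simp add: mult_nonneg_nonpos)
    moreover have "r powr (1 + b) * sin (b * \<phi>) > 0" using r pos by simp
    ultimately show ?thesis using pos by (simp add: S_def)
  next
    case False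
    hence S: "S > 0" by simp
    have lt: "(1 + b) * \<phi> < pi"
    proof (rule ccontr)
      assume "\<not> ?thesis"
      moreover have "(1 + b) * \<phi> < 2 * pi" using b phi by (intro mult_strict_mono) auto
      ultimately have "S \<le> 0" unfolding S_def by (intro sin_le_zero) auto
      thus False using S by simp
    qed
    have s1: "b / (1 + b) * S < sin (b * \<phi>)"
      using sin_strictly_concave[of 0 "(1 + b) * \<phi>" "b / (1 + b)"] lt b phi by (simp add: S_def)
    have s2: "1 / (1 + b) * S < sin \<phi>"
      using sin_strictly_concave[of 0 "(1 + b) * \<phi>" "1 / (1 + b)"] lt b phi by (simp add: S_def)
    have "r powr b = (r powr (1 + b)) powr (b / (1 + b))"
      using b by (simp add: powr_powr)
    also have "\<dots> \<le> 1 - b / (1 + b) + b / (1 + b) * r powr (1 + b)"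
      using r b by (intro powr_le_chord) auto
    also have "1 - b / (1 + b) = 1 / (1 + b)" using b by (simp add: field_simps)
    finally have "r powr b * S \<le> (1 / (1 + b) + b / (1 + b) * r powr (1 + b)) * S"
      using S by (intro mult_right_mono) auto
    also have "\<dots> = r powr (1 + b) * (b / (1 + b) * S) + 1 / (1 + b) * S"
      by (simp add: algebra_simps)
    also have "\<dots> < r powr (1 + b) * sin (b * \<phi>) + sin \<phi>"
      using s1 s2 r by (intro add_strict_mono mult_strict_left_mono) auto
    finally show ?thesis by (simp add: S_def)
  qed
qed

section \<open>Proper holomorphic maps of degree one\<close>

text \<open>Near a critical point a nonconstant function is \<open>f x\<close> plus the \<open>n\<close>-th power of a local
  coordinate, with \<open>n \<ge> 2\<close>, so each nearby value other than \<open>f x\<close> has \<open>n\<close> distinct roots.\<close>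

lemma critical_point_two_preimages:
  fixes f :: "complex \<Rightarrow> complex"
  assumes holf: "f holomorphic_on ball x \<rho>" and rho: "\<rho> > 0" and crit: "deriv f x = 0"
    and nc: "\<not> f constant_on ball x \<rho>"
  obtains \<epsilon> where "\<epsilon> > 0"
    "\<And>\<zeta>. \<zeta> \<noteq> f x \<Longrightarrow> dist \<zeta> (f x) < \<epsilon> \<Longrightarrow>
       \<exists>u\<in>ball x \<rho>. \<exists>v\<in>ball x \<rho>. u \<noteq> v \<and> f u = \<zeta> \<and> f v = \<zeta>"
proof -
  have "\<exists>n>0. (deriv ^^ n) f x \<noteq> 0"
  proof (rule ccontr)
    assume zero: "\<not> ?thesis"
    have "f w = f x" if "w \<in> ball x \<rho>" for w
      using zero that rho
      by (intro holomorphic_fun_eq_const_on_connected[OF holf open_ball connected_ball])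
        (blast, auto)
    thus False using nc by (auto simp: constant_on_def)
  qed
  then obtain n where n: "n > 0" "(deriv ^^ n) f x \<noteq> 0"
    and least: "\<And>i. 0 < i \<Longrightarrow> i < n \<Longrightarrow> (deriv ^^ i) f x = 0"
    using exists_least_iff[of "\<lambda>n. n > 0 \<and> (deriv ^^ n) f x \<noteq> 0"] by blast
  have "n \<noteq> 1" using n crit by auto
  hence n2: "n \<ge> 2" using n by auto
  obtain g r where r: "r > 0" and holg: "g holomorphic_on ball x r"
    and fg: "\<And>w. w \<in> ball x r \<Longrightarrow> f w - f x = ((w - x) * g w) ^ n"
    and g0: "\<And>w. w \<in> ball x r \<Longrightarrow> g w \<noteq> 0"
    by (rule holomorphic_factor_order_of_zero_strong[OF holf open_ball _ n(1,2) least]) (use rho in auto)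
  define h where "h = (\<lambda>w. (w - x) * g w)"
  have holh: "h holomorphic_on ball x (min r \<rho>)"
    unfolding h_def by (intro holomorphic_intros holomorphic_on_subset[OF holg]) auto
  have "(g has_field_derivative deriv g x) (at x)"
    using holg r by (intro holomorphic_derivI[of g "ball x r"]) auto
  hence "(h has_field_derivative g x) (at x)"
    unfolding h_def by (auto intro!: derivative_eq_intros)
  hence dh: "deriv h x \<noteq> 0" using g0[of x] r by (simp add: DERIV_imp_deriv)
  obtain s where s: "s > 0" "ball x s \<subseteq> ball x (min r \<rho>)" "open (h ` ball x s)"
    by (rule has_complex_derivative_locally_invertible[OF holh _ open_ball dh]) (use r rho in auto)
  have "h x \<in> h ` ball x s" using s by auto
  then obtain e where "e > 0" "ball (h x) e \<subseteq> h ` ball x s"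
    using openE[OF s(3)] by blast
  hence e: "e > 0" "ball 0 e \<subseteq> h ` ball x s" by (simp_all add: h_def)
  show ?thesis
  proof (rule that[of "e ^ n"])
    show "e ^ n > 0" using e by simp
  next
    fix \<zeta> assume z: "\<zeta> \<noteq> f x" "dist \<zeta> (f x) < e ^ n"
    define \<eta> where "\<eta> = exp (Ln (\<zeta> - f x) / of_nat n)"
    have \<eta>: "\<eta> ^ n = \<zeta> - f x" using z n by (simp add: \<eta>_def flip: exp_of_nat_mult)
    have root: "(\<eta> * cis (2 * pi / n)) ^ n = \<zeta> - f x"
      using \<eta> n by (simp add: power_mult_distrib Complex.DeMoivre)
    have "norm \<eta> ^ n < e ^ n" using z \<eta> by (simp add: dist_norm flip: norm_power)
    from power_less_imp_less_base[OF this] e(1) have "norm \<eta> < e" by simp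
    hence "\<eta> \<in> ball 0 e" "\<eta> * cis (2 * pi / n) \<in> ball 0 e" by (simp_all add: norm_mult)
    hence "\<eta> \<in> h ` ball x s" "\<eta> * cis (2 * pi / n) \<in> h ` ball x s" using e(2) by blast+
    then obtain u v where uv: "u \<in> ball x s" "v \<in> ball x s" "h u = \<eta>" "h v = \<eta> * cis (2 * pi / n)"
      by auto
    from this(1,2) have "u \<in> ball x r" "v \<in> ball x r" using s(2) by auto
    hence "f u - f x = h u ^ n" "f v - f x = h v ^ n" by (simp_all only: fg h_def)
    hence "f u = \<zeta>" "f v = \<zeta>" using uv(3,4) \<eta> root by simp_all
    moreover have "u \<noteq> v"
    proof
      assume "u = v"
      moreover have "\<eta> \<noteq> 0" by (simp add: \<eta>_def)
      ultimately have "cis (2 * pi / n) = 1" using uv by simp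
      hence "cos (2 * pi / n) = 1" by (simp add: complex_eq_iff)
      moreover have "cos (2 * pi / n) < cos 0"
        using n2 by (intro cos_monotone_0_pi) (auto simp: field_simps)
      ultimately show False by simp
    qed
    ultimately show "\<exists>u\<in>ball x \<rho>. \<exists>v\<in>ball x \<rho>. u \<noteq> v \<and> f u = \<zeta> \<and> f v = \<zeta>"
      using uv(1,2) s(2) by (intro bexI[of _ u] bexI[of _ v]) auto
  qed
qed

text \<open>The degree argument in elementary form. The set \<open>W\<close> of values that are taken exactly once,
  and at a regular point, is open, because by properness the preimages of nearby values stay close
  to the single one. Its complement in \<open>V\<close> is open as well: two distinct preimages persist by the
  open mapping theorem, and a critical one splits by the preceding lemma. As \<open>V\<close> is connected
  and \<open>W\<close> is nonempty, \<open>W = V\<close>.\<close>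

lemma proper_holomorphic_bij_betw:
  fixes f :: "complex \<Rightarrow> complex"
  assumes U: "open U" and V: "open V" "connected V"
    and holf: "f holomorphic_on U" and fUV: "f ` U \<subseteq> V"
    and proper: "\<And>x \<zeta>. (\<And>n::nat. x n \<in> U) \<Longrightarrow> (\<lambda>n. f (x n)) \<longlonglongrightarrow> \<zeta> \<Longrightarrow> \<zeta> \<in> V \<Longrightarrow>
                    \<exists>u\<in>U. \<exists>r. strict_mono r \<and> (x \<circ> r) \<longlonglongrightarrow> u"
    and base: "z0 \<in> U" "deriv f z0 \<noteq> 0" "\<And>z. z \<in> U \<Longrightarrow> f z = f z0 \<Longrightarrow> z = z0"
  shows "bij_betw f U V"
proof -
  have contf: "isCont f u" if "u \<in> U" for u
    using holomorphic_on_imp_continuous_on[OF holf] U that continuous_on_eq_continuous_at by blast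
  have proper': "\<exists>u\<in>U. \<exists>r. strict_mono r \<and> (x \<circ> r) \<longlonglongrightarrow> u \<and> f u = \<zeta>"
    if x: "\<And>n::nat. x n \<in> U" and lim: "(\<lambda>n. f (x n)) \<longlonglongrightarrow> \<zeta>" and "\<zeta> \<in> V" for x \<zeta>
  proof -
    obtain u r where u: "u \<in> U" "strict_mono r" "(x \<circ> r) \<longlonglongrightarrow> u" using proper[OF x lim \<open>\<zeta> \<in> V\<close>] by blast
    have "(\<lambda>n. f ((x \<circ> r) n)) \<longlonglongrightarrow> f u" using isCont_tendsto_compose[OF contf] u by blast
    moreover have "(\<lambda>n. f ((x \<circ> r) n)) \<longlonglongrightarrow> \<zeta>"
      using LIMSEQ_subseq_LIMSEQ[OF lim u(2)] by (simp add: o_def)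
    ultimately have "f u = \<zeta>" using LIMSEQ_unique by blast
    thus ?thesis using u by blast
  qed
  (* A fibre with interior would be closed in the plane by properness, hence the whole plane. *)
  have nonconst: "\<not> f constant_on ball u \<rho>" if u: "u \<in> U" "\<rho> > 0" "ball u \<rho> \<subseteq> U" for u \<rho>
  proof
    assume "f constant_on ball u \<rho>"
    then obtain c where c: "\<And>y. y \<in> ball u \<rho> \<Longrightarrow> f y = c" by (auto simp: constant_on_def)
    define C where "C = {x \<in> U. \<exists>r>0. ball x r \<subseteq> U \<and> (\<forall>y\<in>ball x r. f y = c)}"
    have uC: "u \<in> C" using u c by (auto simp: C_def)
    have cV: "c \<in> V" using c[of u] u fUV by auto
    have "open C"
      unfolding open_contains_ball
    proof
      fix x assume "x \<in> C"
      then obtain r where r: "r > 0" "ball x r \<subseteq> U" "\<And>y. y \<in> ball x r \<Longrightarrow> f y = c"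
        by (auto simp: C_def)
      have "ball x r \<subseteq> C"
      proof
        fix y assume y: "y \<in> ball x r"
        then obtain d where d: "d > 0" "ball y d \<subseteq> ball x r" using openE[OF open_ball] by blast
        hence "ball y d \<subseteq> U \<and> (\<forall>y'\<in>ball y d. f y' = c)" using r by blast
        thus "y \<in> C" using d(1) y r by (auto simp: C_def)
      qed
      thus "\<exists>e>0. ball x e \<subseteq> C" using r by auto
    qed
    moreover have "closed C"
      unfolding closed_sequential_limits
    proof (intro allI impI, elim conjE)
      fix x l assume x: "\<forall>n. x n \<in> C" "x \<longlonglongrightarrow> l"
      have "y \<in> U" "f y = c" if "y \<in> C" for y using that by (auto simp: C_def)
      hence "x n \<in> U" "f (x n) = c" for n using x(1) by auto
      then obtain l' r where l': "l' \<in> U" "strict_mono r" "(x \<circ> r) \<longlonglongrightarrow> l'"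
        using proper[of x c] cV by auto
      hence "l' = l" using LIMSEQ_subseq_LIMSEQ[OF x(2)] LIMSEQ_unique by blast
      hence "l \<in> U" using l' by simp
      then obtain d where d: "d > 0" "ball l d \<subseteq> U" using U openE by blast
      obtain n where n: "x n \<in> ball l d"
        using topological_tendstoD[OF x(2) open_ball, of l d] d by (auto simp: eventually_sequentially)
      obtain r' where r': "r' > 0" "\<And>y. y \<in> ball (x n) r' \<Longrightarrow> f y = c"
        using x(1) unfolding C_def by blast
      have "f y = c" if "y \<in> ball l d" for y
      proof (rule analytic_continuation_open[of "ball (x n) r' \<inter> ball l d" "ball l d" f "\<lambda>_. c"])
        show "ball (x n) r' \<inter> ball l d \<noteq> {}" using n r' by (metis IntI centre_in_ball empty_iff)
        show "f holomorphic_on ball l d" using holf d holomorphic_on_subset by blast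
      qed (use r' that in auto)
      thus "l \<in> C" using d \<open>l \<in> U\<close> by (auto simp: C_def)
    qed
    ultimately have "C = UNIV" using uC clopen[of C] by auto
    moreover have "y \<in> U" "f y = c" if "y \<in> C" for y using that by (auto simp: C_def)
    ultimately have "f (z0 + 1) = f z0" "z0 + 1 \<in> U" by auto
    from base(3)[OF this(2,1)] show False by simp
  qed
  have openf: "\<exists>\<epsilon>>0. ball (f u) \<epsilon> \<subseteq> f ` ball u \<rho>" if "u \<in> U" "\<rho> > 0" "ball u \<rho> \<subseteq> U" for u \<rho>
  proof -
    have "open (f ` ball u \<rho>)"
      using that nonconst[of u \<rho>] holf holomorphic_on_subset
      by (intro open_mapping_thm[of f "ball u \<rho>"]) auto
    moreover have "f u \<in> f ` ball u \<rho>" using that by auto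
    ultimately show ?thesis unfolding open_contains_ball by blast
  qed
  define W where "W = {\<zeta> \<in> V. \<exists>z\<in>U. f z = \<zeta> \<and> deriv f z \<noteq> 0 \<and> (\<forall>z'\<in>U. f z' = \<zeta> \<longrightarrow> z' = z)}"
  have "closed (- W)"
    unfolding closed_sequential_limits
  proof (intro allI impI, elim conjE)
    fix x l assume x: "\<forall>n. x n \<in> - W" "x \<longlonglongrightarrow> l"
    show "l \<in> - W"
    proof (rule ccontr)
      assume "l \<notin> - W"
      then obtain z where l: "l \<in> V" and z: "z \<in> U" "f z = l" "deriv f z \<noteq> 0"
        and uniq: "\<And>z'. z' \<in> U \<Longrightarrow> f z' = l \<Longrightarrow> z' = z" unfolding W_def by blast
      obtain \<rho> where rho: "\<rho> > 0" "ball z \<rho> \<subseteq> U" "inj_on f (ball z \<rho>)"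
        using has_complex_derivative_locally_injective[OF holf z(1) U z(3)] by blast
      have reg: "deriv f y \<noteq> 0" if "y \<in> ball z \<rho>" for y
        using holomorphic_injective_imp_regular[OF holomorphic_on_subset[OF holf rho(2)] open_ball rho(3) that] .
      obtain \<epsilon> where eps: "\<epsilon> > 0" "ball l \<epsilon> \<subseteq> f ` ball z \<rho>" using openf[OF z(1) rho(1,2)] z(2) by auto
      have "eventually (\<lambda>n. x n \<in> V \<inter> ball l \<epsilon>) sequentially"
        using V(1) l eps(1) by (intro topological_tendstoD[OF x(2)]) auto
      then obtain N where N: "\<And>n. n \<ge> N \<Longrightarrow> x n \<in> V \<and> x n \<in> ball l \<epsilon>"
        by (auto simp: eventually_sequentially)
      have "\<exists>y\<in>U. f y = x (n + N) \<and> y \<notin> ball z \<rho>" for n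
      proof -
        have "x (n + N) \<in> f ` ball z \<rho>" using N[of "n + N"] eps(2) by auto
        then obtain y where y: "y \<in> ball z \<rho>" "f y = x (n + N)" by (metis imageE)
        have "x (n + N) \<notin> W" "x (n + N) \<in> V" using x(1) N[of "n + N"] by auto
        then obtain y' where "y' \<in> U" "f y' = x (n + N)" "y' \<noteq> y"
          using y reg[OF y(1)] rho(2) unfolding W_def by blast
        moreover from this have "y' \<notin> ball z \<rho>" using y inj_onD[OF rho(3), of y' y] by auto
        ultimately show ?thesis by blast
      qed
      then obtain y where y: "\<And>n. y n \<in> U" "\<And>n. f (y n) = x (n + N)" "\<And>n. y n \<notin> ball z \<rho>" by metis
      have "(\<lambda>n. f (y n)) \<longlonglongrightarrow> l" unfolding y(2) using LIMSEQ_ignore_initial_segment[OF x(2)] .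
      from proper'[OF y(1) this l] obtain u r where u: "u \<in> U" "(y \<circ> r) \<longlonglongrightarrow> u" "f u = l" by blast
      have "(y \<circ> r) \<longlonglongrightarrow> z" using u uniq by blast
      hence "eventually (\<lambda>n. (y \<circ> r) n \<in> ball z \<rho>) sequentially"
        using rho(1) topological_tendstoD[OF _ open_ball, of "y \<circ> r" z] by simp
      thus False using y(3) by (auto simp: eventually_sequentially)
    qed
  qed
  hence openW: "open W" by (simp add: open_closed)
  have "closed (- (V - W))"
    unfolding closed_sequential_limits
  proof (intro allI impI, elim conjE)
    fix x l assume x: "\<forall>n. x n \<in> - (V - W)" "x \<longlonglongrightarrow> l"
    show "l \<in> - (V - W)"
    proof (rule ccontr)
      assume "l \<notin> - (V - W)"
      hence l: "l \<in> V" "l \<notin> W" by auto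
      obtain N where N: "\<And>n. n \<ge> N \<Longrightarrow> x n \<in> V"
        using topological_tendstoD[OF x(2) V(1) l(1)] by (auto simp: eventually_sequentially)
      have NW: "x n \<in> W" if "n \<ge> N" for n using x(1) N[OF that] by auto
      have twice: False if "n \<ge> N" "u \<in> U" "v \<in> U" "u \<noteq> v" "f u = x n" "f v = x n" for n u v
        using NW[OF that(1)] that(2-) unfolding W_def by blast
      have "\<exists>y\<in>U. f y = x (n + N)" for n using NW[of "n + N"] unfolding W_def by auto
      then obtain y where y: "\<And>n. y n \<in> U" "\<And>n. f (y n) = x (n + N)" by metis
      have "(\<lambda>n. f (y n)) \<longlonglongrightarrow> l" unfolding y(2) using LIMSEQ_ignore_initial_segment[OF x(2)] .
      from proper'[OF y(1) this l(1)] obtain u where u: "u \<in> U" "f u = l" by blast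
      have close: "\<exists>n\<ge>N. x n \<in> ball l \<epsilon>" if "\<epsilon> > 0" for \<epsilon>
      proof -
        have "eventually (\<lambda>n. x n \<in> ball l \<epsilon>) sequentially"
          using that by (intro topological_tendstoD[OF x(2)]) auto
        then obtain M where "\<And>n. n \<ge> M \<Longrightarrow> x n \<in> ball l \<epsilon>" by (auto simp: eventually_sequentially)
        thus ?thesis by (intro exI[of _ "max M N"]) auto
      qed
      show False
      proof (cases "deriv f u = 0")
        case True
        obtain \<rho> where rho: "\<rho> > 0" "ball u \<rho> \<subseteq> U" using U u openE by blast
        obtain \<epsilon> where eps: "\<epsilon> > 0" "\<And>\<zeta>. \<zeta> \<noteq> f u \<Longrightarrow> dist \<zeta> (f u) < \<epsilon> \<Longrightarrow>
            \<exists>v\<in>ball u \<rho>. \<exists>w\<in>ball u \<rho>. v \<noteq> w \<and> f v = \<zeta> \<and> f w = \<zeta>"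
          using critical_point_two_preimages[OF holomorphic_on_subset[OF holf rho(2)] rho(1) True
              nonconst[OF u(1) rho]] by blast
        obtain n where n: "n \<ge> N" "x n \<in> ball l \<epsilon>" using close eps(1) by blast
        have "x n \<noteq> f u" using NW[OF n(1)] u l by auto
        moreover have "dist (x n) (f u) < \<epsilon>" using n(2) u by (simp add: dist_commute)
        ultimately obtain v w where "v \<in> U" "w \<in> U" "v \<noteq> w" "f v = x n" "f w = x n"
          using eps(2) rho(2) by blast
        thus False using twice[OF n(1)] by blast
      next
        case False
        then obtain v where v: "v \<in> U" "f v = l" "v \<noteq> u" using l u unfolding W_def by blast
        then obtain A B where AB: "open A" "open B" "u \<in> A" "v \<in> B" "A \<inter> B = {}"
          using hausdorff by metis
        obtain \<rho> where rho: "\<rho> > 0" "ball u \<rho> \<subseteq> U \<inter> A" using U AB(1,3) u openE[of "U \<inter> A" u] by auto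
        obtain \<sigma> where sig: "\<sigma> > 0" "ball v \<sigma> \<subseteq> U \<inter> B" using U AB(2,4) v openE[of "U \<inter> B" v] by auto
        obtain \<epsilon>1 where e1: "\<epsilon>1 > 0" "ball l \<epsilon>1 \<subseteq> f ` ball u \<rho>" using openf[of u \<rho>] u rho by auto
        obtain \<epsilon>2 where e2: "\<epsilon>2 > 0" "ball l \<epsilon>2 \<subseteq> f ` ball v \<sigma>" using openf[of v \<sigma>] v sig by auto
        obtain n where n: "n \<ge> N" "x n \<in> ball l (min \<epsilon>1 \<epsilon>2)" using close[of "min \<epsilon>1 \<epsilon>2"] e1 e2 by auto
        have "x n \<in> f ` ball u \<rho>" "x n \<in> f ` ball v \<sigma>" using n(2) e1(2) e2(2) by auto
        then obtain p q where p: "p \<in> ball u \<rho>" "f p = x n" and q: "q \<in> ball v \<sigma>" "f q = x n"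
          by (metis imageE)
        have "p \<in> A" "q \<in> B" "p \<in> U" "q \<in> U" using p q rho sig by auto
        thus False using twice[OF n(1), of p q] p q AB(5) by blast
      qed
    qed
  qed
  hence "open (V - W)" by (simp add: open_closed)
  hence "W \<inter> V = {} \<or> (V - W) \<inter> V = {}" by (intro connectedD[OF V(2) openW]) auto
  moreover have "f z0 \<in> W" using base fUV unfolding W_def by blast
  moreover have "f z0 \<in> V" using base fUV by blast
  ultimately have "V \<subseteq> W" by blast
  hence VW: "\<And>\<zeta>. \<zeta> \<in> V \<Longrightarrow> \<exists>z\<in>U. f z = \<zeta> \<and> (\<forall>z'\<in>U. f z' = \<zeta> \<longrightarrow> z' = z)"
    unfolding W_def by blast
  have "inj_on f U"
  proof (rule inj_onI)
    fix u v assume "u \<in> U" "v \<in> U" "f u = f v"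
    moreover from this fUV have "f u \<in> V" by blast
    ultimately show "u = v" using VW[of "f u"] by metis
  qed
  moreover have "V \<subseteq> f ` U"
  proof
    fix \<zeta> assume "\<zeta> \<in> V"
    then obtain z where "z \<in> U" "f z = \<zeta>" using VW by blast
    thus "\<zeta> \<in> f ` U" by blast
  qed
  with fUV have "f ` U = V" by (rule equalityI)
  ultimately show ?thesis by (simp add: bij_betw_def)
qed

section \<open>Local behaviour of continuous and holomorphic functions\<close>

lemma open_if_eventually_nhds:
  assumes "\<And>x. x \<in> S \<Longrightarrow> eventually (\<lambda>y. y \<in> S) (nhds x)"
  shows "open S"
proof (subst open_subopen, intro ballI)
  fix x assume "x \<in> S"
  from assms[OF this] show "\<exists>T. open T \<and> x \<in> T \<and> T \<subseteq> S" unfolding eventually_nhds by blast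
qed

lemma isCont_tendsto_nhds: "isCont f x \<Longrightarrow> (f \<longlongrightarrow> f x) (nhds x)"
  unfolding isCont_def tendsto_at_iff_tendsto_nhds .

lemma eventually_nhds_greater:
  fixes f :: "'a::t2_space \<Rightarrow> real"
  shows "isCont f x \<Longrightarrow> c < f x \<Longrightarrow> eventually (\<lambda>y. c < f y) (nhds x)"
  by (rule order_tendstoD(1)[OF isCont_tendsto_nhds])

lemma eventually_nhds_neq:
  fixes f :: "'a::t2_space \<Rightarrow> 'b::t1_space"
  shows "isCont f x \<Longrightarrow> f x \<noteq> c \<Longrightarrow> eventually (\<lambda>y. f y \<noteq> c) (nhds x)"
  by (rule tendsto_imp_eventually_ne[OF isCont_tendsto_nhds])

text \<open>A function with a positive derivative at a real point moves vertical displacements upwards.\<close>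

lemma Im_pos_above_real_point:
  assumes f: "(f has_field_derivative of_real D) (at (of_real x))" and D: "D > 0" and real: "Im (f (of_real x)) = 0"
  shows "eventually (\<lambda>e. Im (f (Complex x e)) > 0) (at_right 0)"
proof -
  have C: "Complex x e = of_real x + \<i> * of_real e" for e by (simp add: complex_eq_iff)
  have "((\<lambda>z. of_real x + \<i> * z) has_field_derivative \<i>) (at (of_real 0))"
    by (auto intro!: derivative_eq_intros)
  moreover have "(f has_field_derivative of_real D) (at (of_real x + \<i> * of_real 0))" using f by simp
  ultimately have "((\<lambda>z. f (of_real x + \<i> * z)) has_field_derivative of_real D * \<i>) (at (of_real 0))"
    by (rule DERIV_chain2[rotated])
  hence "((\<lambda>e. f (Complex x e)) has_vector_derivative of_real D * \<i>) (at 0)"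
    unfolding C by (rule has_vector_derivative_real_field)
  hence "((\<lambda>e. Im (f (Complex x e))) has_real_derivative Im (of_real D * \<i>)) (at 0)"
    unfolding has_real_derivative_iff_has_vector_derivative
    by (rule bounded_linear.has_vector_derivative[OF bounded_linear_Im])
  hence "((\<lambda>e. Im (f (Complex x e))) has_real_derivative D) (at 0)" by simp
  from DERIV_pos_inc_right[OF this D] obtain d where "d > 0"
    "\<And>h. 0 < h \<Longrightarrow> h < d \<Longrightarrow> Im (f (Complex x 0)) < Im (f (Complex x (0 + h)))" by auto
  moreover have "Complex x 0 = of_real x" by (simp add: complex_eq_iff)
  ultimately show ?thesis unfolding eventually_at_right_field using real by auto
qed

section \<open>A logarithm that is continuous on the closed upper half-plane\<close>

text \<open>The cut is the negative imaginary axis. On the closed upper half-plane without \<open>0\<close> this is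
  the principal logarithm, but unlike \<open>Ln\<close> it is analytic in a neighbourhood of each point of
  that set, so limits at negative reals need no special treatment.\<close>

definition lg :: "complex \<Rightarrow> complex" where
  "lg z = Ln (- \<i> * z) + \<i> * of_real (pi / 2)"

lemma exp_lg: "z \<noteq> 0 \<Longrightarrow> exp (lg z) = z"
proof -
  have "exp (\<i> * complex_of_real (pi / 2)) = \<i>"
    by (simp only: cis_conv_exp[symmetric] cis_pi_half)
  thus "z \<noteq> 0 \<Longrightarrow> exp (lg z) = z" by (simp add: lg_def exp_add mult.assoc mult.left_commute[of \<i> z])
qed

lemma lg_has_field_derivative:
  assumes "Im z > 0 \<or> Re z \<noteq> 0"
  shows "(lg has_field_derivative 1 / z) (at z)"
proof -
  have "- \<i> * z \<notin> \<real>\<^sub>\<le>\<^sub>0" "z \<noteq> 0"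
    using assms by (auto simp: complex_nonpos_Reals_iff)
  thus ?thesis unfolding lg_def
    by (auto intro!: derivative_eq_intros simp: field_simps)
qed

lemma isCont_lg: "Im z > 0 \<or> Re z \<noteq> 0 \<Longrightarrow> isCont lg z"
  using lg_has_field_derivative DERIV_isCont by blast

lemma Im_lg_bounds:
  assumes "z \<noteq> 0"
  shows "Im z \<ge> 0 \<Longrightarrow> 0 \<le> Im (lg z) \<and> Im (lg z) \<le> pi"
    and "Im z > 0 \<Longrightarrow> 0 < Im (lg z) \<and> Im (lg z) < pi"
  using Re_Ln_pos_le[of "- \<i> * z"] Re_Ln_pos_lt[of "- \<i> * z"] assms
  by (auto simp: lg_def abs_le_iff abs_less_iff)

lemma lg_eq_Ln:
  assumes "Im z \<ge> 0" "z \<noteq> 0"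
  shows "lg z = Ln z"
proof -
  have "Ln z = lg z"
    using Im_lg_bounds(1)[of z] assms exp_lg[of z] by (intro Ln_unique) (auto simp: pi_gt_zero intro: less_le_trans[of _ 0])
  thus ?thesis by simp
qed

lemma Re_lg: "z \<noteq> 0 \<Longrightarrow> Re (lg z) = ln (cmod z)"
  by (simp add: lg_def norm_mult)

lemma lg_of_real: "x > 0 \<Longrightarrow> lg (of_real x) = of_real (ln x)"
  by (simp add: lg_eq_Ln Ln_of_real)

lemma exp_of_real_mult_lg:
  assumes "z \<noteq> 0"
  shows "exp (of_real c * lg z) = of_real (cmod z powr c) * cis (c * Im (lg z))"
  using assms by (simp add: exp_eq_polar Re_lg powr_def)

lemma exp_mult_lg_of_real: "x > 0 \<Longrightarrow> exp (of_real c * lg (of_real x)) = of_real (x powr c)"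
  by (simp add: lg_of_real powr_def exp_of_real flip: of_real_mult)

lemma polar_lg: "z \<noteq> 0 \<Longrightarrow> z = of_real (cmod z) * cis (Im (lg z))"
  using exp_of_real_mult_lg[of z 1] by (simp add: exp_lg)

section \<open>The two ratios as functions of one complex variable\<close>

locale exponent =
  fixes \<alpha> :: real
  assumes alpha: "\<alpha> > 1"

context exponent begin

definition b :: real where "b = 1 / \<alpha>"

lemma b: "0 < b" "b < 1" "b * \<alpha> = 1" "\<alpha> * b = 1"
  using alpha by (auto simp: b_def)

definition Q :: "complex \<Rightarrow> complex" where
  "Q X = 1 + exp (of_real b * lg X) * (X - 1)"

definition Y :: "complex \<Rightarrow> complex" where
  "Y X = exp (of_real (1 + \<alpha>) * lg X - of_real \<alpha> * lg (Q X))"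

text \<open>The argument of \<open>Y X\<close> that results from continuing the logarithms through the upper half-plane;
  it need not lie in \<open>(-\<pi>, \<pi>]\<close>.\<close>

definition argY :: "complex \<Rightarrow> real" where
  "argY X = (1 + \<alpha>) * Im (lg X) - \<alpha> * Im (lg (Q X))"

definition Z :: "complex \<Rightarrow> complex" where
  "Z X = (X - 1) / (Y X - 1)"

lemma Y_polar:
  assumes "X \<noteq> 0" "Q X \<noteq> 0"
  shows "Y X = of_real (cmod X powr (1 + \<alpha>) / cmod (Q X) powr \<alpha>) * cis (argY X)"
  using assms by (simp add: Y_def exp_eq_polar Re_lg argY_def exp_diff powr_def)

lemma Q_polar:
  assumes "X \<noteq> 0"
  defines "r \<equiv> cmod X" and "\<theta> \<equiv> Im (lg X)"
  shows "Re (Q X) = 1 + r powr b * (r * cos ((1 + b) * \<theta>) - cos (b * \<theta>))"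
    and "Im (Q X) = r powr b * (r * sin ((1 + b) * \<theta>) - sin (b * \<theta>))"
proof -
  have "Q X = 1 + of_real (r powr b) * cis (b * \<theta>) * (of_real r * cis \<theta> - 1)"
    unfolding Q_def using exp_of_real_mult_lg[OF assms(1), of b] polar_lg[OF assms(1)]
    by (simp add: r_def \<theta>_def)
  also have "\<dots> = 1 + of_real (r powr b) * (of_real r * cis ((1 + b) * \<theta>) - cis (b * \<theta>))"
    by (simp add: algebra_simps flip: cis_mult)
  finally show "Re (Q X) = 1 + r powr b * (r * cos ((1 + b) * \<theta>) - cos (b * \<theta>))"
    and "Im (Q X) = r powr b * (r * sin ((1 + b) * \<theta>) - sin (b * \<theta>))"
    by simp_all
qed

definition dQ :: "complex \<Rightarrow> complex" where
  "dQ X = exp (of_real b * lg X) * (of_real b * (X - 1) / X + 1)"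

definition dY :: "complex \<Rightarrow> complex" where
  "dY X = Y X * (of_real (1 + \<alpha>) / X - of_real \<alpha> * dQ X / Q X)"

lemma Q_has_field_derivative:
  assumes "Im X > 0 \<or> Re X \<noteq> 0"
  shows "(Q has_field_derivative dQ X) (at X)"
  unfolding Q_def dQ_def
  by (rule derivative_eq_intros lg_has_field_derivative assms refl)+ (simp add: algebra_simps)

lemma Y_has_field_derivative:
  assumes "Im X > 0 \<or> Re X \<noteq> 0" "Im (Q X) > 0 \<or> Re (Q X) \<noteq> 0"
  shows "(Y has_field_derivative dY X) (at X)"
proof -
  have "((\<lambda>X. lg (Q X)) has_field_derivative 1 / Q X * dQ X) (at X)"
    using DERIV_chain2[OF lg_has_field_derivative[OF assms(2)] Q_has_field_derivative[OF assms(1)]] .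
  hence "((\<lambda>X. of_real (1 + \<alpha>) * lg X - of_real \<alpha> * lg (Q X)) has_field_derivative
     of_real (1 + \<alpha>) * (1 / X) - of_real \<alpha> * (1 / Q X * dQ X)) (at X)"
    by (intro DERIV_diff DERIV_cmult lg_has_field_derivative[OF assms(1)])
  from DERIV_chain2[OF DERIV_exp this] show ?thesis
    unfolding Y_def[abs_def] dY_def by simp
qed

lemma Z_has_field_derivative:
  assumes "Im X > 0 \<or> Re X \<noteq> 0" "Im (Q X) > 0 \<or> Re (Q X) \<noteq> 0" "Y X \<noteq> 1"
  shows "(Z has_field_derivative ((Y X - 1) - (X - 1) * dY X) / (Y X - 1)\<^sup>2) (at X)"
  unfolding Z_def[abs_def]
  by (rule derivative_eq_intros Y_has_field_derivative assms refl)+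
    (use assms in \<open>simp_all add: power2_eq_square\<close>)

lemma isCont_Q: "Im X > 0 \<or> Re X \<noteq> 0 \<Longrightarrow> isCont Q X"
  using Q_has_field_derivative DERIV_isCont by blast

lemma isCont_Y:
  "Im X > 0 \<or> Re X \<noteq> 0 \<Longrightarrow> Im (Q X) > 0 \<or> Re (Q X) \<noteq> 0 \<Longrightarrow> isCont Y X"
  using Y_has_field_derivative DERIV_isCont by blast

lemma isCont_argY:
  assumes "Im X > 0 \<or> Re X \<noteq> 0" "Im (Q X) > 0 \<or> Re (Q X) \<noteq> 0"
  shows "isCont argY X"
proof -
  have "isCont (\<lambda>X. lg (Q X)) X"
    using isCont_o2[OF isCont_Q[OF assms(1)] isCont_lg[OF assms(2)]] .
  thus ?thesis unfolding argY_def[abs_def]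
    by (intro continuous_intros isCont_Im isCont_lg[OF assms(1)])
qed

section \<open>The curve on which Q is real\<close>

text \<open>Reality of \<open>Q X\<close> means \<open>r sin ((1 + b) \<theta>) = sin (b \<theta>)\<close>. This determines \<open>X\<close> by its argument, and
  \<open>X - 1\<close> has argument \<open>\<pi> - b \<theta>\<close>. The sign of \<open>Im (Z X)\<close> is therefore that of
  \<open>|Y X| sin (b \<theta> + arg (Y X)) - sin (b \<theta>)\<close>.\<close>

lemma Im_Z_neg_on_critical_curve:
  assumes X: "Im X > 0" and Q: "Im (Q X) = 0" "Q X \<noteq> 0" and arg: "\<bar>argY X\<bar> < pi"
  shows "Im (Z X) < 0"
proof -
  have X0: "X \<noteq> 0" using X by auto
  define r \<theta> q \<eta> where "r = cmod X" and "\<theta> = Im (lg X)" and "q = Re (Q X)" and "\<eta> = argY X"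
  define A B \<rho> where "A = sin ((1 + b) * \<theta>)" and "B = b * \<theta>"
    and "\<rho> = r powr (1 + \<alpha>) / \<bar>q\<bar> powr \<alpha>"
  have r: "r > 0" using X0 by (simp add: r_def)
  have th: "0 < \<theta>" "\<theta> < pi" using Im_lg_bounds(2)[OF X0 X] by (auto simp: \<theta>_def)
  have "b * \<theta> < 1 * \<theta>" using b th by (intro mult_strict_right_mono) auto
  hence "B < pi" using th unfolding B_def by linarith
  moreover have "0 < B" using b th by (simp add: B_def)
  ultimately have B: "0 < B" "B < pi" by auto
  hence sB: "sin B > 0" by (intro sin_gt_zero)
  have rA: "r * A = sin B"
    using Q_polar(2)[OF X0] Q r by (simp add: r_def[symmetric] \<theta>_def[symmetric] A_def B_def)
  hence A: "A > 0" using r sB zero_less_mult_pos by metis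
  have lt: "(1 + b) * \<theta> < pi"
  proof (rule ccontr)
    assume "\<not> ?thesis"
    moreover have "(1 + b) * \<theta> < 2 * pi" using b th by (intro mult_strict_mono) auto
    ultimately have "A \<le> 0" unfolding A_def by (intro sin_le_zero) (auto simp: not_less)
    thus False using A by simp
  qed
  have sth: "sin \<theta> > 0" using th by (intro sin_gt_zero)
  have th_eq: "(1 + b) * \<theta> = \<theta> + B" by (simp add: B_def algebra_simps)
  have ex: "A = sin \<theta> * cos B + cos \<theta> * sin B" unfolding A_def th_eq by (rule sin_add)
  have q: "q = 1 - r powr b * sin \<theta> / A"
  proof -
    have "(r * cos (\<theta> + B) - cos B) * A = sin B * cos (\<theta> + B) - cos B * A"
      using rA by (simp add: algebra_simps)
    also have "\<dots> = sin B * (cos \<theta> * cos B - sin \<theta> * sin B) - cos B * (sin \<theta> * cos B + cos \<theta> * sin B)"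
      unfolding ex cos_add by simp
    also have "\<dots> = - (sin \<theta> * (sin B * sin B + cos B * cos B))"
      by (simp add: algebra_simps del: sin_cos_squared_add3)
    also have "sin B * sin B + cos B * cos B = 1"
      using sin_cos_squared_add[of B] by (simp only: power2_eq_square)
    finally have "r * cos (\<theta> + B) - cos B = - sin \<theta> / A" using A by (simp add: field_simps)
    thus ?thesis using Q_polar(1)[OF X0] th_eq
      by (simp add: q_def r_def[symmetric] \<theta>_def[symmetric] B_def[symmetric])
  qed
  have Qq: "Q X = of_real q" using Q by (simp add: complex_eq_iff q_def)
  hence q0: "q \<noteq> 0" using Q by auto
  have "\<eta> = (1 + \<alpha>) * \<theta> - \<alpha> * (if q > 0 then 0 else pi)"
    using q0 by (auto simp: \<eta>_def argY_def Qq lg_of_real \<theta>_def lg_eq_Ln Im_Ln_eq_pi not_less)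
  hence ineq: "\<rho> * sin (B + \<eta>) < sin B"
    unfolding \<rho>_def B_def
    using critical_curve_sine_bound[OF alpha b_def th(1) lt, of r q \<eta>] rA q q0 arg
    by (simp add: A_def B_def \<eta>_def)
  have Y: "Y X = of_real \<rho> * cis \<eta>"
    using Y_polar[OF X0 Q(2)] by (simp add: Qq \<rho>_def r_def \<eta>_def)
  have AX: "of_real A * (X - 1) = of_real (sin \<theta>) * Complex (- cos B) (sin B)"
  proof (rule complex_eqI)
    have Xe: "Re X = r * cos \<theta>" "Im X = r * sin \<theta>"
      using polar_lg[OF X0] by (metis Re_complex_of_real Im_complex_of_real complex_surj r_def \<theta>_def
        Re_rcis Im_rcis rcis_def)+
    have "A * (r * cos \<theta> - 1) = sin B * cos \<theta> - A" using rA by (simp add: algebra_simps)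
    thus "Re (of_real A * (X - 1)) = Re (of_real (sin \<theta>) * Complex (- cos B) (sin B))"
      by (simp add: Xe ex)
    show "Im (of_real A * (X - 1)) = Im (of_real (sin \<theta>) * Complex (- cos B) (sin B))"
      using rA by (simp add: Xe algebra_simps)
  qed
  have "A * Im ((X - 1) * cnj (Y X - 1)) = Im (of_real A * (X - 1) * cnj (Y X - 1))"
    by (simp add: algebra_simps)
  also have "\<dots> = sin \<theta> * (\<rho> * sin (B + \<eta>) - sin B)"
    unfolding AX Y by (simp add: sin_add algebra_simps)
  also have "\<dots> < 0" using sth ineq by (simp add: mult_pos_neg)
  finally have "Im ((X - 1) * cnj (Y X - 1)) < 0" using A by (simp add: mult_less_0_iff)
  thus ?thesis unfolding Z_def Im_complex_div_lt_0 .
qed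

section \<open>No values beyond 1 off the real axis\<close>

text \<open>The Pick function \<open>1 - x^(-b)\<close>. In terms of it the recursion of the orbit takes the
  symmetric form \<open>h X = X * h (Y X)\<close> on the principal branch of \<open>Y\<close>.\<close>

definition h :: "complex \<Rightarrow> complex" where
  "h x = 1 - exp (- (of_real b * lg x))"

lemma Im_h_pos:
  assumes "Im x > 0"
  shows "Im (h x) > 0"
proof -
  have x: "x \<noteq> 0" using assms by auto
  have "b * Im (lg x) < 1 * pi"
    using b Im_lg_bounds(2)[OF x assms] by (intro mult_strict_mono) auto
  hence "sin (b * Im (lg x)) > 0"
    using b Im_lg_bounds(2)[OF x assms] by (intro sin_gt_zero mult_pos_pos) auto
  thus ?thesis using exp_of_real_mult_lg[OF x, of "- b"] x by (simp add: h_def)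
qed

lemma h_has_field_derivative:
  assumes "Im x > 0 \<or> Re x \<noteq> 0"
  shows "(h has_field_derivative of_real b * exp (- (of_real b * lg x)) / x) (at x)"
  unfolding h_def by (auto intro!: derivative_eq_intros lg_has_field_derivative assms)

text \<open>The logarithmic derivative \<open>(x - 1) h'(x) / h(x)\<close> equals \<open>b (x - 1) / (x (x^b - 1))\<close>, so its
  imaginary part has the sign opposite to that in \<open>sine_young\<close>.\<close>

lemma Im_log_derivative_h_neg:
  assumes "Im x > 0"
  shows "Im ((x - 1) * (of_real b * exp (- (of_real b * lg x)) / x / h x)) < 0"
proof -
  have x: "x \<noteq> 0" using assms by auto
  define r \<phi> where "r = cmod x" and "\<phi> = Im (lg x)"
  have r: "r > 0" using x by (simp add: r_def)
  have phi: "0 < \<phi>" "\<phi> < pi" using Im_lg_bounds(2)[OF x assms] by (auto simp: \<phi>_def)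
  define E where "E = exp (of_real b * lg x)"
  have E: "E = of_real (r powr b) * cis (b * \<phi>)"
    using exp_of_real_mult_lg[OF x] by (simp add: E_def r_def \<phi>_def)
  have xp: "x = of_real r * cis \<phi>" using polar_lg[OF x] by (simp add: r_def \<phi>_def)
  have cis_sum: "cis (- ((1 + b) * \<phi>)) = cis (- \<phi>) * cis (- (b * \<phi>))"
    by (simp add: cis_mult algebra_simps)
  have "(x - 1) * cnj (x * (E - 1))
      = (of_real r * cis \<phi> - 1) * (of_real r * (of_real (r powr b) * cis (- ((1 + b) * \<phi>)) - cis (- \<phi>)))"
    unfolding E xp cis_sum by (simp add: algebra_simps cis_cnj)
  also have "\<dots> = of_real r * (of_real (r * r powr b) * (cis \<phi> * cis (- ((1 + b) * \<phi>)))
      - of_real r * (cis \<phi> * cis (- \<phi>)) - of_real (r powr b) * cis (- ((1 + b) * \<phi>)) + cis (- \<phi>))"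
    unfolding of_real_mult by algebra
  also have "cis \<phi> * cis (- ((1 + b) * \<phi>)) = cis (- (b * \<phi>))"
    unfolding cis_mult by (simp add: algebra_simps)
  also have "cis \<phi> * cis (- \<phi>) = 1" unfolding cis_mult by simp
  finally have prod: "(x - 1) * cnj (x * (E - 1)) = of_real r * (of_real (r * r powr b) * cis (- (b * \<phi>))
      - of_real r * 1 - of_real (r powr b) * cis (- ((1 + b) * \<phi>)) + cis (- \<phi>))" .
  define \<psi> where "\<psi> = (1 + b) * \<phi>"
  have "Im ((x - 1) * cnj (x * (E - 1)))
      = r * (r powr b * sin ((1 + b) * \<phi>) - (r powr (1 + b) * sin (b * \<phi>) + sin \<phi>))"
    unfolding prod \<psi>_def[symmetric] using r by (simp add: powr_add algebra_simps)
  also have "\<dots> < 0"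
    using sine_young[OF r phi b(1,2)] r by (simp add: mult_pos_neg)
  finally have "Im ((x - 1) / (x * (E - 1))) < 0" by (simp add: Im_complex_div_lt_0)
  moreover have "(x - 1) * (of_real b * exp (- (of_real b * lg x)) / x / h x)
      = of_real b * ((x - 1) / (x * (E - 1)))"
  proof -
    have "E \<noteq> 0" by (simp add: E_def)
    moreover have "h x \<noteq> 0" using Im_h_pos[OF assms] by auto
    moreover have hE: "h x = 1 - 1 / E" "exp (- (of_real b * lg x)) = 1 / E"
      by (simp_all add: h_def E_def exp_minus field_simps)
    ultimately have "E \<noteq> 1" by auto
    thus ?thesis unfolding hE using \<open>E \<noteq> 0\<close> x by (simp add: field_simps)
  qed
  ultimately show ?thesis using b by (simp add: mult_pos_neg del: times_divide_eq_right)
qed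

text \<open>Along \<open>t \<mapsto> 1 + t (X - 1)\<close> the derivative of \<open>Ln \<circ> h\<close> is \<open>1/t\<close> times the logarithmic derivative of
  the preceding lemma.\<close>

lemma Arg_h_strict_antimono_on_ray:
  assumes X: "Im X > 0" and s: "0 < s" "s < 1"
  shows "Im (Ln (h X)) < Im (Ln (h (1 + of_real s * (X - 1))))"
proof -
  define p where "p = (\<lambda>t. 1 + complex_of_real t * (X - 1))"
  have Imp: "Im (p t) > 0" if "t > 0" for t using that X by (simp add: p_def)
  have "Im (Ln (h (p 1))) < Im (Ln (h (p s)))"
  proof (rule DERIV_neg_imp_decreasing[OF s(2)])
    fix t assume t: "s \<le> t" "t \<le> 1"
    hence t0: "t > 0" using s by simp
    define H where "H = of_real b * exp (- (of_real b * lg (p t))) / p t"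
    define D where "D = H * (X - 1) / h (p t)"
    have pt: "Im (p t) > 0" using Imp[OF t0] .
    have hp: "Im (h (p t)) > 0" using Im_h_pos[OF pt] .
    have "((\<lambda>z. 1 + z * (X - 1)) has_field_derivative (X - 1)) (at (of_real t))"
      by (auto intro!: derivative_eq_intros)
    moreover have "(h has_field_derivative H) (at (1 + of_real t * (X - 1)))"
      unfolding H_def using h_has_field_derivative pt by (simp add: p_def)
    ultimately have dh: "((\<lambda>z. h (1 + z * (X - 1))) has_field_derivative H * (X - 1)) (at (of_real t))"
      by (rule DERIV_chain2[rotated])
    have "h (1 + of_real t * (X - 1)) \<notin> \<real>\<^sub>\<le>\<^sub>0"
      using hp by (auto simp: p_def complex_nonpos_Reals_iff)
    from DERIV_chain2[OF has_field_derivative_Ln[OF this] dh]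
    have "((\<lambda>z. Ln (h (1 + z * (X - 1)))) has_field_derivative D) (at (of_real t))"
      by (simp add: D_def p_def field_simps)
    hence "((\<lambda>t. Ln (h (p t))) has_vector_derivative D) (at t)"
      unfolding p_def by (rule has_vector_derivative_real_field)
    hence "((\<lambda>t. Im (Ln (h (p t)))) has_real_derivative Im D) (at t)"
      unfolding has_real_derivative_iff_has_vector_derivative
      by (rule bounded_linear.has_vector_derivative[OF bounded_linear_Im])
    moreover have "Im D < 0"
    proof -
      have "(p t - 1) * (H / h (p t)) = of_real t * D" by (simp add: p_def D_def)
      hence "t * Im D < 0"
        using Im_log_derivative_h_neg[OF pt] unfolding H_def[symmetric] by simp
      thus ?thesis using t0 by (simp add: mult_less_0_iff)
    qed
    ultimately show "\<exists>y. ((\<lambda>t. Im (Ln (h (p t)))) has_real_derivative y) (at t) \<and> y < 0" by blast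
  qed
  thus ?thesis by (simp add: p_def)
qed

lemma Ln_Y:
  assumes "\<bar>argY X\<bar> < pi"
  shows "Ln (Y X) = of_real (1 + \<alpha>) * lg X - of_real \<alpha> * lg (Q X)"
  unfolding Y_def using assms by (intro Ln_exp) (auto simp: argY_def)

lemma h_eq_mult_h_Y:
  assumes "X \<noteq> 0" "Q X \<noteq> 0" "\<bar>argY X\<bar> < pi" "Im (Y X) \<ge> 0"
  shows "h X = X * h (Y X)"
proof -
  have "lg (Y X) = of_real (1 + \<alpha>) * lg X - of_real \<alpha> * lg (Q X)"
    using Ln_Y[OF assms(3)] assms(4) by (simp add: lg_eq_Ln Y_def)
  hence "of_real b * lg (Y X) = of_real b * (of_real (1 + \<alpha>) * lg X - of_real \<alpha> * lg (Q X))"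
    by simp
  hence "of_real b * lg (Y X) = of_real (b * (1 + \<alpha>)) * lg X - of_real (b * \<alpha>) * lg (Q X)"
    by (simp add: algebra_simps)
  also have "b * (1 + \<alpha>) = 1 + b" using b by (simp add: algebra_simps)
  finally have "- (of_real b * lg (Y X)) = lg (Q X) - lg X - of_real b * lg X"
    using b by (simp add: algebra_simps)
  hence "X * h (Y X) = X * (1 - Q X / X / exp (of_real b * lg X))"
    using assms by (simp add: h_def exp_diff exp_lg)
  also have "\<dots> = h X"
    using assms by (simp add: Q_def h_def exp_minus field_simps)
  finally show ?thesis by simp
qed

lemma Z_not_real_gt_1:
  assumes X: "Im X > 0" and Q: "Q X \<noteq> 0" and arg: "\<bar>argY X\<bar> < pi"
    and Z: "Im (Z X) = 0" "Re (Z X) > 1"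
  shows False
proof -
  define s where "s = 1 / Re (Z X)"
  have s: "0 < s" "s < 1" using Z by (auto simp: s_def)
  have Zs: "Z X = of_real (1 / s)" using Z by (simp add: s_def complex_eq_iff)
  have Y1: "Y X \<noteq> 1" using Z by (auto simp: Z_def)
  have "(X - 1) / (Y X - 1) = of_real (1 / s)" using Zs by (simp add: Z_def)
  hence Y: "Y X = 1 + of_real s * (X - 1)" using Y1 s by (simp add: field_simps)
  have ImY: "Im (Y X) > 0" using X s by (simp add: Y)
  have X0: "X \<noteq> 0" using X by auto
  have rel: "h X = X * h (Y X)" using h_eq_mult_h_Y[OF X0 Q arg] ImY by simp
  have hX: "Im (h X) > 0" and hY: "Im (h (Y X)) > 0" using Im_h_pos X ImY by auto
  hence nz: "h X \<noteq> 0" "h (Y X) \<noteq> 0" by auto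
  (* Both arguments lie between 0 and pi, so their negative difference exceeds - pi. *)
  define d where "d = Ln (h X) - Ln (h (Y X))"
  have "X = exp d" using rel nz by (simp add: d_def exp_diff)
  moreover have "Im d < 0" using Arg_h_strict_antimono_on_ray[OF X s] by (simp add: d_def Y)
  moreover have "Im d > - pi"
    using Im_Ln_pos_lt[OF nz(1)] Im_Ln_pos_lt[OF nz(2)] hX hY by (simp add: d_def)
  ultimately have "Im X < 0"
    using sin_gt_zero[of "- Im d"] by (simp add: Im_exp mult_pos_neg)
  thus False using X by simp
qed

section \<open>The positive real axis\<close>

definition q :: "real \<Rightarrow> real" where "q x = 1 + x powr b * (x - 1)"

definition y :: "real \<Rightarrow> real" where "y x = x powr (1 + \<alpha>) / q x powr \<alpha>"

lemma q_pos: "x > 0 \<Longrightarrow> q x > 0"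
proof (cases "x \<ge> 1")
  case True
  thus ?thesis by (simp add: q_def add_pos_nonneg)
next
  case False
  assume x: "x > 0"
  have "x powr b * (1 - x) < 1 * 1"
    using False x b by (intro mult_le_less_imp_less powr_le1) auto
  thus ?thesis by (simp add: q_def algebra_simps)
qed

lemma y_pos: "x > 0 \<Longrightarrow> y x > 0"
  using q_pos[of x] by (simp add: y_def)

lemma Q_of_real: "x > 0 \<Longrightarrow> Q (of_real x) = of_real (q x)"
  by (simp add: Q_def q_def exp_mult_lg_of_real)

lemma Y_of_real: "x > 0 \<Longrightarrow> Y (of_real x) = of_real (y x)"
  using q_pos[of x]
  by (simp add: Y_def y_def Q_of_real exp_diff exp_mult_lg_of_real del: of_real_add)

lemma Z_of_real: "x > 0 \<Longrightarrow> Z (of_real x) = of_real ((x - 1) / (y x - 1))"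
  by (simp add: Z_def Y_of_real)

lemma dQ_of_real:
  assumes "x > 0"
  shows "dQ (of_real x) = of_real (x powr b * (b * (x - 1) / x + 1))"
  using assms by (simp add: dQ_def exp_mult_lg_of_real)

text \<open>Passing to the power \<open>-b\<close> makes \<open>y\<close> rational in \<open>x\<close> and \<open>x powr (-b)\<close>. All comparisons of \<open>y\<close>
  with \<open>x\<close> and with \<open>1\<close> are made in this form.\<close>

lemma y_powr_neg_b:
  assumes "x > 0"
  defines "u \<equiv> x powr (- b)"
  shows "y x powr (- b) = (u + x - 1) / x" and "q x = (u + x - 1) / u"
proof -
  have u: "u > 0" "x powr b = 1 / u" using assms by (auto simp: powr_minus field_simps)
  show q: "q x = (u + x - 1) / u" using u by (simp add: q_def field_simps)
  have "y x powr (- b) = x powr (- b * (1 + \<alpha>)) / q x powr (- b * \<alpha>)"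
    using q_pos[OF assms(1)] assms(1) by (simp add: y_def powr_divide powr_powr mult_ac)
  also have "- b * (1 + \<alpha>) = - b - 1" using b by (simp add: algebra_simps)
  also have "- b * \<alpha> = - 1" using b by simp
  also have "x powr (- b - 1) / q x powr (- 1) = (u + x - 1) / x"
  proof -
    have "x powr (- b - 1) = u / x" using assms(1) by (simp add: powr_diff u_def)
    moreover have "q x powr (- 1) = 1 / q x" using q_pos[OF assms(1)] by (simp add: powr_minus_divide)
    ultimately show ?thesis using q_pos[OF assms(1)] u(1) assms(1) by (simp add: q)
  qed
  finally show "y x powr (- b) = (u + x - 1) / x" .
qed

lemma powr_neg_b_less_iff: "s > 0 \<Longrightarrow> t > 0 \<Longrightarrow> s powr (- b) < t powr (- b) \<longleftrightarrow> t < s"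
  using powr_less_mono2_neg[of "- b" s t] powr_less_mono2_neg[of "- b" t s] b
  by (cases s t rule: linorder_cases) auto

lemma y_less: "x > 0 \<Longrightarrow> x \<noteq> 1 \<Longrightarrow> y x < x"
proof -
  assume x: "x > 0" "x \<noteq> 1"
  define u where "u = x powr (- b)"
  have "0 < (1 - u) * (x - 1)"
  proof (cases "x > 1")
    case True
    hence "u < 1" using powr_neg_b_less_iff[of x 1] by (simp add: u_def)
    thus ?thesis using True by simp
  next
    case False
    hence "u > 1" using x powr_neg_b_less_iff[of 1 x] by (simp add: u_def)
    thus ?thesis using False x by (simp add: mult_neg_neg)
  qed
  hence "u < (u + x - 1) / x" using x by (simp add: field_simps)
  hence "x powr (- b) < y x powr (- b)" using y_powr_neg_b(1)[OF x(1)] by (simp add: u_def)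
  thus "y x < x" using powr_neg_b_less_iff x y_pos by simp
qed

lemma y_gt_1: "x > 1 \<Longrightarrow> y x > 1"
proof -
  assume x: "x > 1"
  have "x powr (- b) < 1" using powr_neg_b_less_iff[of x 1] x by simp
  hence "y x powr (- b) < 1 powr (- b)" using y_powr_neg_b(1)[of x] x by simp
  thus "y x > 1" using powr_neg_b_less_iff[of "y x" 1] y_pos[of x] x by simp
qed

lemma Z_of_real_gt_1: "x > 1 \<Longrightarrow> (x - 1) / (y x - 1) > 1"
  using y_less[of x] y_gt_1[of x] by (simp add: field_simps)

lemma Z_of_real_less_1: "0 < x \<Longrightarrow> x < 1 \<Longrightarrow> (x - 1) / (y x - 1) < 1"
  using y_less[of x] by (simp add: field_simps)

text \<open>The numerator of the derivative of \<open>Z\<close> is \<open>(y - 1) - (x - 1) y'\<close>. With \<open>u = x powr (-b)\<close> and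
  \<open>v = y powr (-b)\<close> one finds \<open>y' = y ((1 + \<alpha>) u - \<alpha>) / (x^2 v)\<close>, and dropping the negative term
  \<open>- \<alpha> (1 - u)\<close> from \<open>(1 + \<alpha>) u - \<alpha> = u - \<alpha> (1 - u)\<close> leaves exactly the comparison of two chord
  slopes of \<open>t powr (1 + b)\<close>.\<close>

lemma Z_deriv_real_pos:
  assumes x: "x > 1"
  obtains D where "D > 0" "(Z has_field_derivative of_real D) (at (of_real x))"
proof -
  define u where "u = x powr (- b)"
  define v where "v = (u + x - 1) / x"
  have u: "0 < u" "u < 1" "x powr b = 1 / u"
    using x powr_neg_b_less_iff[of x 1] by (auto simp: u_def powr_minus field_simps)
  have v: "v > 0" "1 - v = (1 - u) / x" using u x by (auto simp: v_def field_simps)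
  have y: "1 < y x" "y x < x" using y_gt_1 y_less x by auto
  have yb: "y x powr b = 1 / v"
  proof -
    have "y x powr (- b) = v" using y_powr_neg_b(1)[of x] x by (simp add: v_def u_def)
    hence "inverse (y x powr b) = v" by (simp only: powr_minus)
    thus ?thesis by (metis inverse_inverse_eq inverse_eq_divide)
  qed
  (* Convexity of t powr (1 + b) bounds the chord slope over [1, y] by the one over [1, x]. *)
  have slope: "y x * (x - 1) * u \<le> x\<^sup>2 * v * (y x - 1)"
  proof -
    have "convex_on {0<..} (\<lambda>t. t powr (1 + b))" using b by (intro powr_convex) auto
    from convex_on_slope_le(1)[OF this, of 1 x "y x"] x y
    have "(1 - y x powr (1 + b)) / (1 - y x) \<le> (1 - x powr (1 + b)) / (1 - x)" by simp
    hence "(y x powr (1 + b) - 1) / (y x - 1) \<le> (x powr (1 + b) - 1) / (x - 1)"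
      by (metis minus_diff_eq minus_divide_divide)
    hence "(y x powr (1 + b) - 1) * (x - 1) \<le> (x powr (1 + b) - 1) * (y x - 1)"
      using x y by (simp add: pos_divide_le_eq pos_le_divide_eq)
    hence "(y x powr (1 + b) - y x) * (x - 1) \<le> (x powr (1 + b) - x) * (y x - 1)"
      by (simp add: algebra_simps)
    hence "u * v * ((y x powr (1 + b) - y x) * (x - 1)) \<le> u * v * ((x powr (1 + b) - x) * (y x - 1))"
      using u v by (intro mult_left_mono) auto
    moreover have ux: "u * x powr (1 + b) = x" and vy: "v * y x powr (1 + b) = y x"
      using u v x y yb by (simp_all add: powr_add)
    have "u * v * ((y x powr (1 + b) - y x) * (x - 1)) = u * (v * y x powr (1 + b) - y x * v) * (x - 1)"
      by (simp add: algebra_simps)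
    hence "u * v * ((y x powr (1 + b) - y x) * (x - 1)) = u * (y x * (1 - v)) * (x - 1)"
      unfolding vy by (simp add: algebra_simps)
    moreover have "u * v * ((x powr (1 + b) - x) * (y x - 1)) = v * (u * x powr (1 + b) - x * u) * (y x - 1)"
      by (simp add: algebra_simps)
    hence "u * v * ((x powr (1 + b) - x) * (y x - 1)) = v * (x * (1 - u)) * (y x - 1)"
      unfolding ux by (simp add: algebra_simps)
    ultimately have "u * (y x * (1 - v)) * (x - 1) \<le> v * (x * (1 - u)) * (y x - 1)" by simp
    hence "x * (u * (y x * ((1 - u) / x)) * (x - 1)) \<le> x * (v * (x * (1 - u)) * (y x - 1))"
      unfolding v(2) using x by (intro mult_left_mono) auto
    moreover have "x * (u * (y x * ((1 - u) / x)) * (x - 1)) = (1 - u) * (y x * (x - 1) * u)"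
      using x by simp
    ultimately have "(1 - u) * (y x * (x - 1) * u) \<le> (1 - u) * (x\<^sup>2 * v * (y x - 1))"
      by (simp add: power2_eq_square mult_ac)
    thus ?thesis using u by simp
  qed
  define y' where "y' = y x * ((1 + \<alpha>) * u - \<alpha>) / (x\<^sup>2 * v)"
  have dY: "dY (of_real x) = of_real y'"
  proof -
    have qv: "q x = x * v / u" using y_powr_neg_b(2)[of x] x by (simp add: v_def u_def)
    have "(1 + \<alpha>) / x - \<alpha> * (x powr b * (b * (x - 1) / x + 1)) / q x
        = ((1 + \<alpha>) * (x * v) - (\<alpha> * b * (x - 1) + \<alpha> * x)) / (x\<^sup>2 * v)"
      unfolding qv u(3) using u(1) v(1) x by (simp add: field_simps power2_eq_square)
    also have "(1 + \<alpha>) * (x * v) - (\<alpha> * b * (x - 1) + \<alpha> * x) = (1 + \<alpha>) * u - \<alpha>"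
    proof -
      have xv: "x * v = u + x - 1" using x by (simp add: v_def)
      show ?thesis unfolding xv using b by (simp add: algebra_simps)
    qed
    finally have quot: "(1 + \<alpha>) / x - \<alpha> * (x powr b * (b * (x - 1) / x + 1)) / q x
        = ((1 + \<alpha>) * u - \<alpha>) / (x\<^sup>2 * v)" .
    have val: "y x * ((1 + \<alpha>) / x - \<alpha> * (x powr b * (b * (x - 1) / x + 1)) / q x) = y'"
      unfolding quot y'_def by (rule times_divide_eq_right)
    have "dY (of_real x) = of_real (y x * ((1 + \<alpha>) / x - \<alpha> * (x powr b * (b * (x - 1) / x + 1)) / q x))"
      using x by (simp add: dY_def dQ_of_real Q_of_real Y_of_real)
    thus ?thesis unfolding val .
  qed
  have "y x * (x - 1) * ((1 + \<alpha>) * u - \<alpha>) < y x * (x - 1) * u"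
  proof (rule mult_strict_left_mono)
    have "\<alpha> * u < \<alpha> * 1" using u(2) alpha by (intro mult_strict_left_mono) auto
    thus "(1 + \<alpha>) * u - \<alpha> < u" by (simp add: distrib_right)
    show "0 < y x * (x - 1)" using x y(1) by (intro mult_pos_pos) linarith+
  qed
  hence "(x - 1) * (y x * ((1 + \<alpha>) * u - \<alpha>)) < (y x - 1) * (x\<^sup>2 * v)"
    using slope by (simp add: mult_ac)
  hence "(x - 1) * y' < y x - 1"
    unfolding y'_def times_divide_eq_right
    using x v(1) by (subst pos_divide_less_eq) simp_all
  hence "((y x - 1) - (x - 1) * y') / (y x - 1)\<^sup>2 > 0" using y by simp
  moreover have "(Z has_field_derivative of_real (((y x - 1) - (x - 1) * y') / (y x - 1)\<^sup>2)) (at (of_real x))"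
    using Z_has_field_derivative[of "of_real x"] x y q_pos[of x]
    by (simp add: Q_of_real Y_of_real dY)
  ultimately show ?thesis using that by blast
qed

lemma Z_of_real_strict_mono:
  assumes "1 < s" "s < t"
  shows "Re (Z (of_real s)) < Re (Z (of_real t))"
proof (rule DERIV_pos_imp_increasing[OF assms(2)])
  fix x assume "s \<le> x" "x \<le> t"
  then obtain D where D: "D > 0" "(Z has_field_derivative of_real D) (at (of_real x))"
    using assms Z_deriv_real_pos[of x] by auto
  have "((\<lambda>x. Z (of_real x)) has_vector_derivative of_real D) (at x)"
    using has_vector_derivative_real_field[OF D(2)] .
  hence "((\<lambda>x. Re (Z (of_real x))) has_real_derivative Re (of_real D)) (at x)"
    unfolding has_real_derivative_iff_has_vector_derivative
    by (rule bounded_linear.has_vector_derivative[OF bounded_linear_Re])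
  thus "\<exists>y. ((\<lambda>x. Re (Z (of_real x))) has_real_derivative y) (at x) \<and> y > 0" using D by auto
qed

lemma Re_Z_of_real_gt_1: "t > 1 \<Longrightarrow> Re (Z (of_real t)) > 1"
  using Z_of_real_gt_1[of t] by (simp add: Z_of_real)

lemma Z_inj_on_real:
  assumes "1 < s" "1 < t" "Z (of_real s) = Z (of_real t)"
  shows "s = t"
  using Z_of_real_strict_mono[of s t] Z_of_real_strict_mono[of t s] assms
  by (cases s t rule: linorder_cases) auto

section \<open>Behaviour at the exceptional boundary points\<close>

text \<open>\<open>Y\<close> fixes \<open>1\<close> and has derivative \<open>1\<close> there.\<close>

lemma Z_tendsto_at_1: "(Z \<longlongrightarrow> 1) (at 1)"
proof -
  have Q1: "Q 1 = 1" by (simp add: Q_def)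
  have Y1: "Y 1 = 1" using Y_of_real[of 1] by (simp add: y_def q_def)
  have "dQ 1 = 1" using dQ_of_real[of 1] by simp
  hence "dY 1 = 1" by (simp add: dY_def Y1 Q1)
  hence "((\<lambda>X. (Y X - 1) / (X - 1)) \<longlongrightarrow> 1) (at 1)"
    using Y_has_field_derivative[of 1] Q1 Y1 by (simp add: has_field_derivative_iff)
  hence "((\<lambda>X. inverse ((Y X - 1) / (X - 1))) \<longlongrightarrow> inverse 1) (at 1)" by (intro tendsto_inverse) auto
  thus ?thesis by (simp add: Z_def[abs_def])
qed

lemma Z_tendsto_at_0: "(Z \<longlongrightarrow> 1) (at 0)"
proof -
  have nz: "eventually (\<lambda>X::complex. X \<noteq> 0) (at 0)" by (simp add: eventually_at_filter)
  have "((\<lambda>X. cmod X powr b) \<longlongrightarrow> 0) (at 0)"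
    using b by (intro tendsto_zero_powrI tendsto_norm_zero tendsto_ident_at) (auto intro!: always_eventually)
  moreover have "eventually (\<lambda>X. cmod X powr b = norm (exp (of_real b * lg X))) (at 0)"
    using nz by eventually_elim (simp add: exp_of_real_mult_lg norm_mult)
  ultimately have "((\<lambda>X. norm (exp (of_real b * lg X))) \<longlongrightarrow> 0) (at 0)"
    by (rule Lim_transform_eventually)
  hence "((\<lambda>X. exp (of_real b * lg X)) \<longlongrightarrow> 0) (at 0)" by (rule tendsto_norm_zero_cancel)
  hence "(Q \<longlongrightarrow> 1 + 0 * (0 - 1)) (at 0)"
    unfolding Q_def[abs_def] by (intro tendsto_intros)
  hence Q: "(Q \<longlongrightarrow> 1) (at 0)" by simp
  have "((\<lambda>X. cmod X powr (1 + \<alpha>)) \<longlongrightarrow> 0) (at 0)"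
    using alpha by (intro tendsto_zero_powrI tendsto_norm_zero tendsto_ident_at) (auto intro!: always_eventually)
  moreover have "((\<lambda>X. cmod (Q X) powr \<alpha>) \<longlongrightarrow> cmod 1 powr \<alpha>) (at 0)"
    by (intro tendsto_powr tendsto_norm Q tendsto_const) auto
  ultimately have "((\<lambda>X. cmod X powr (1 + \<alpha>) / cmod (Q X) powr \<alpha>) \<longlongrightarrow> 0 / (cmod 1 powr \<alpha>)) (at 0)"
    by (intro tendsto_divide) auto
  hence "((\<lambda>X. cmod X powr (1 + \<alpha>) / cmod (Q X) powr \<alpha>) \<longlongrightarrow> 0) (at 0)" by simp
  moreover have "eventually (\<lambda>X. Q X \<noteq> 0) (at 0)"
    using Q by (rule tendsto_imp_eventually_ne) auto
  hence "eventually (\<lambda>X. cmod X powr (1 + \<alpha>) / cmod (Q X) powr \<alpha> = norm (Y X)) (at 0)"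
    using nz by eventually_elim (simp add: Y_polar norm_mult norm_divide)
  ultimately have "((\<lambda>X. norm (Y X)) \<longlongrightarrow> 0) (at 0)" by (rule Lim_transform_eventually)
  hence "(Y \<longlongrightarrow> 0) (at 0)" by (rule tendsto_norm_zero_cancel)
  hence "(Z \<longlongrightarrow> (0 - 1) / (0 - 1)) (at 0)"
    unfolding Z_def[abs_def] by (intro tendsto_intros) auto
  thus ?thesis by simp
qed

text \<open>At a root of \<open>Q\<close> the function \<open>Y\<close> has a branched pole, so the limit is computed with \<open>1/Y\<close>.\<close>

lemma Z_tendsto_0_at_root_of_Q:
  assumes X: "Im X > 0" and Q: "Q X = 0" and lim: "(f \<longlongrightarrow> X) F" and nz: "eventually (\<lambda>n. Q (f n) \<noteq> 0) F"
  shows "((\<lambda>n. Z (f n)) \<longlongrightarrow> 0) F"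
proof -
  have X0: "X \<noteq> 0" using X by auto
  have "isCont Q X" using Q_has_field_derivative X DERIV_isCont by blast
  hence "((\<lambda>n. Q (f n)) \<longlongrightarrow> 0) F" using isCont_tendsto_compose[OF _ lim] Q by force
  hence "((\<lambda>n. cmod (Q (f n)) powr \<alpha>) \<longlongrightarrow> 0) F"
    using alpha by (intro tendsto_zero_powrI[where b = \<alpha>] tendsto_norm_zero) (auto intro!: always_eventually)
  moreover have "((\<lambda>n. cmod (f n) powr (1 + \<alpha>)) \<longlongrightarrow> cmod X powr (1 + \<alpha>)) F"
    using X0 by (intro tendsto_powr tendsto_norm lim tendsto_const) auto
  ultimately have "((\<lambda>n. cmod (Q (f n)) powr \<alpha> / cmod (f n) powr (1 + \<alpha>)) \<longlongrightarrow> 0 / cmod X powr (1 + \<alpha>)) F"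
    using X0 by (intro tendsto_divide) auto
  hence "((\<lambda>n. cmod (Q (f n)) powr \<alpha> / cmod (f n) powr (1 + \<alpha>)) \<longlongrightarrow> 0) F" by simp
  moreover have "eventually (\<lambda>n. f n \<noteq> 0) F" using lim X0 by (rule tendsto_imp_eventually_ne)
  hence "eventually (\<lambda>n. cmod (Q (f n)) powr \<alpha> / cmod (f n) powr (1 + \<alpha>) = norm (inverse (Y (f n)))) F"
    using nz by eventually_elim (simp add: Y_polar norm_mult norm_divide norm_inverse)
  ultimately have "((\<lambda>n. norm (inverse (Y (f n)))) \<longlongrightarrow> 0) F" by (rule Lim_transform_eventually)
  hence "((\<lambda>n. inverse (Y (f n))) \<longlongrightarrow> 0) F" by (rule tendsto_norm_zero_cancel)
  hence "((\<lambda>n. (f n - 1) * inverse (Y (f n)) / (1 - inverse (Y (f n)))) \<longlongrightarrow> (X - 1) * 0 / (1 - 0)) F"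
    by (intro tendsto_intros lim) auto
  moreover have "(f n - 1) * inverse (Y (f n)) / (1 - inverse (Y (f n))) = Z (f n)" for n
  proof -
    have "Y (f n) \<noteq> 0" by (simp add: Y_def)
    thus ?thesis by (cases "Y (f n) = 1") (simp_all add: Z_def field_simps)
  qed
  ultimately show ?thesis by simp
qed

text \<open>Since \<open>Q X\<close> is close to \<open>X^(1+b)\<close> for large \<open>X\<close>, \<open>Y\<close> stays bounded and \<open>Z\<close> grows at least linearly.
  The radius \<open>4\<close> is enough for \<open>|Q X| \<ge> |X|^(1+b) / 2\<close>.\<close>

lemma norm_Z_ge:
  assumes X: "cmod X \<ge> 4"
  shows "cmod (Z X) \<ge> (cmod X - 1) / (2 powr \<alpha> + 1) \<or> Y X = 1"
proof -
  define r where "r = cmod X"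
  have r: "r \<ge> 4" using X by (simp add: r_def)
  have X0: "X \<noteq> 0" using X by auto
  have rb: "r powr b \<ge> 1" using r b by (intro ge_one_powr_ge_zero) auto
  have "r powr (1 + b) / 2 = r powr b * (r / 2)" using r by (simp add: powr_add)
  also have "\<dots> \<le> r powr b * (r - 2)" using r by (intro mult_left_mono) auto
  also have "\<dots> \<le> r powr b * (r - 1) - 1" using rb by (simp add: algebra_simps)
  also have "\<dots> \<le> cmod (exp (of_real b * lg X)) * cmod (X - 1) - 1"
    using norm_triangle_ineq2[of X 1] exp_of_real_mult_lg[OF X0, of b] r
    by (intro diff_right_mono mult_mono) (auto simp: r_def norm_mult)
  also have "\<dots> \<le> cmod (Q X)"
    using norm_triangle_ineq2[of "exp (of_real b * lg X) * (X - 1)" "-1"] by (simp add: Q_def norm_mult add.commute)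
  finally have Qr: "r powr (1 + b) / 2 \<le> cmod (Q X)" .
  have pos: "r powr (1 + b) / 2 > 0" using r by simp
  hence Q0: "Q X \<noteq> 0" using Qr by auto
  have "(r powr (1 + b) / 2) powr \<alpha> \<le> cmod (Q X) powr \<alpha>"
    using Qr alpha r by (intro powr_mono2) auto
  moreover have "(r powr (1 + b) / 2) powr \<alpha> = r powr (1 + \<alpha>) / 2 powr \<alpha>"
  proof -
    have "(1 + b) * \<alpha> = 1 + \<alpha>" using b by (simp add: algebra_simps)
    thus ?thesis using r by (simp add: powr_divide powr_powr)
  qed
  ultimately have "r powr (1 + \<alpha>) / 2 powr \<alpha> \<le> cmod (Q X) powr \<alpha>" by simp
  hence "r powr (1 + \<alpha>) / cmod (Q X) powr \<alpha> \<le> 2 powr \<alpha>"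
    using Q0 by (simp add: field_simps)
  hence "cmod (Y X) \<le> 2 powr \<alpha>"
    using Y_polar[OF X0 Q0] by (simp add: r_def norm_mult norm_divide)
  hence Y: "cmod (Y X - 1) \<le> 2 powr \<alpha> + 1" using norm_triangle_ineq4[of "Y X" 1] by simp
  have X1: "cmod X - 1 \<le> cmod (X - 1)" using norm_triangle_ineq2[of X 1] by simp
  show ?thesis
  proof (cases "Y X = 1")
    case False
    hence "(cmod X - 1) / (2 powr \<alpha> + 1) \<le> cmod (X - 1) / cmod (Y X - 1)"
      using X X1 Y by (intro frac_le) auto
    thus ?thesis by (simp add: Z_def norm_divide)
  qed auto
qed

lemma Im_Q_neg_on_negative_axis:
  assumes "x < 0"
  shows "Im (Q (of_real x)) < 0"
proof -
  have x: "of_real x \<noteq> (0::complex)" using assms by simp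
  have "lg (of_real x) = Ln (of_real x)" using assms by (intro lg_eq_Ln) auto
  hence th: "Im (lg (of_real x)) = pi" using assms by (simp add: Im_Ln_eq_pi)
  have "sin (b * pi) > 0" using b by (intro sin_gt_zero) auto
  moreover have "sin ((1 + b) * pi) = - sin (b * pi)" by (simp add: algebra_simps sin_add)
  ultimately have "- x * sin ((1 + b) * pi) - sin (b * pi) < 0"
    using assms by (simp add: mult_neg_pos add_neg_neg)
  moreover have "cmod (of_real x) powr b > 0" using assms by simp
  ultimately show ?thesis unfolding Q_polar(2)[OF x] th using assms by (simp add: mult_pos_neg)
qed

section \<open>Conformal equivalence with the upper half-plane\<close>

text \<open>Continuing an inverse of \<open>Z\<close> from the boundary piece \<open>(1, \<infinity>)\<close> into the upper half-plane leads
  to this set. The bound on \<open>argY\<close> selects the branch: at its ends \<open>Y\<close> is negative and \<open>Z\<close>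
  lies in the lower half-plane.\<close>

definition U :: "complex set" where
  "U = {X. Im X > 0 \<and> Im (Q X) > 0 \<and> \<bar>argY X\<bar> < pi \<and> Im (Z X) > 0}"

text \<open>An open set on which the formula for \<open>Z\<close> is holomorphic; it contains \<open>U\<close> and its boundary
  piece \<open>(1, \<infinity>)\<close>.\<close>

definition dom_Z :: "complex set" where
  "dom_Z = {X. (Im X > 0 \<or> Re X \<noteq> 0) \<and> (Im (Q X) > 0 \<or> Re (Q X) \<noteq> 0) \<and> Y X \<noteq> 1}"

lemma isCont_Z: "X \<in> dom_Z \<Longrightarrow> isCont Z X"
  using Z_has_field_derivative DERIV_isCont unfolding dom_Z_def by blast

lemma open_dom_Z: "open dom_Z"
proof (rule open_if_eventually_nhds)
  fix X assume "X \<in> dom_Z"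
  hence X: "Im X > 0 \<or> Re X \<noteq> 0" "Im (Q X) > 0 \<or> Re (Q X) \<noteq> 0" "Y X \<noteq> 1" by (auto simp: dom_Z_def)
  have half: "eventually (\<lambda>y. Im (f y) > 0 \<or> Re (f y) \<noteq> 0) (nhds X)"
    if "isCont f X" "Im (f X) > 0 \<or> Re (f X) \<noteq> 0" for f :: "complex \<Rightarrow> complex"
  proof (cases "Im (f X) > 0")
    case True
    thus ?thesis using eventually_nhds_greater[OF isCont_Im[OF that(1)], of 0]
      by (auto elim: eventually_mono)
  next
    case False
    thus ?thesis using eventually_nhds_neq[OF isCont_Re[OF that(1)], of 0] that(2)
      by (auto elim: eventually_mono)
  qed
  have "eventually (\<lambda>y. Y y \<noteq> 1) (nhds X)"
    using eventually_nhds_neq[OF isCont_Y] X by blast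
  thus "eventually (\<lambda>y. y \<in> dom_Z) (nhds X)"
    unfolding dom_Z_def mem_Collect_eq
    using half[of "\<lambda>x. x", OF _ X(1)] half[OF isCont_Q[OF X(1)] X(2)]
    by (auto intro: eventually_conj)
qed

lemma U_subset_dom_Z: "U \<subseteq> dom_Z"
proof
  fix X assume "X \<in> U"
  hence "Im (Z X) > 0" "Im X > 0" "Im (Q X) > 0" by (auto simp: U_def)
  moreover from this(1) have "Y X \<noteq> 1" by (auto simp: Z_def)
  ultimately show "X \<in> dom_Z" by (auto simp: dom_Z_def)
qed

lemma holomorphic_Z: "Z holomorphic_on dom_Z"
proof -
  have "\<exists>D. (Z has_field_derivative D) (at X)" if "X \<in> dom_Z" for X
    using that Z_has_field_derivative[of X] unfolding dom_Z_def by blast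
  thus ?thesis using holomorphic_on_open[OF open_dom_Z] by blast
qed

lemma open_U: "open U"
proof (rule open_if_eventually_nhds)
  fix X assume U: "X \<in> U"
  hence X: "Im X > 0" "Im (Q X) > 0" "\<bar>argY X\<bar> < pi" "Im (Z X) > 0" by (auto simp: U_def)
  have "eventually (\<lambda>y. 0 < Im y) (nhds X)"
    using X by (intro eventually_nhds_greater) auto
  moreover have "eventually (\<lambda>y. 0 < Im (Q y)) (nhds X)"
    using X by (intro eventually_nhds_greater isCont_Im isCont_Q) auto
  moreover have "eventually (\<lambda>y. 0 < pi - \<bar>argY y\<bar>) (nhds X)"
    using X by (intro eventually_nhds_greater continuous_intros isCont_argY) auto
  moreover have "eventually (\<lambda>y. 0 < Im (Z y)) (nhds X)"
    using X U U_subset_dom_Z by (intro eventually_nhds_greater isCont_Im isCont_Z) auto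
  ultimately show "eventually (\<lambda>y. y \<in> U) (nhds X)"
    by eventually_elim (auto simp: U_def)
qed

lemma Y_of_real_ne_1: "x > 0 \<Longrightarrow> x \<noteq> 1 \<Longrightarrow> Y (of_real x) \<noteq> 1"
  using y_less[of x] y_gt_1[of x] by (cases "x > 1") (auto simp: Y_of_real)

lemma of_real_in_dom_Z: "x > 0 \<Longrightarrow> x \<noteq> 1 \<Longrightarrow> of_real x \<in> dom_Z"
  using q_pos[of x] Y_of_real_ne_1[of x] by (simp add: dom_Z_def Q_of_real)

lemma bounded_if_Z_bounded:
  assumes "\<And>n. x n \<in> U" "\<And>n. cmod (Z (x n)) \<le> K"
  shows "cmod (x n) \<le> max 4 (K * (2 powr \<alpha> + 1) + 1)"
proof (cases "cmod (x n) \<ge> 4")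
  case True
  have "Y (x n) \<noteq> 1" using assms(1) U_subset_dom_Z by (auto simp: dom_Z_def)
  hence "(cmod (x n) - 1) / (2 powr \<alpha> + 1) \<le> K"
    using norm_Z_ge[OF True] assms(2)[of n] by linarith
  moreover have "2 powr \<alpha> + 1 > (0::real)" by (simp add: add_pos_pos)
  ultimately have "cmod (x n) - 1 \<le> K * (2 powr \<alpha> + 1)" by (simp add: pos_divide_le_eq)
  thus ?thesis by simp
qed simp

text \<open>Properness of \<open>Z\<close> on \<open>U\<close>, together with its boundary version for \<open>\<zeta> > 1\<close>. A limit point \<open>l\<close> is
  located by exclusion. The values of \<open>Z\<close> tend to \<open>1\<close> at \<open>0\<close> and \<open>1\<close>, and to \<open>0\<close> at roots of \<open>Q\<close>;
  on \<open>(0, 1)\<close> they are real and less than \<open>1\<close>; negative reals are not limits because \<open>Q\<close> is in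
  the lower half-plane there. At points of the upper half-plane with \<open>Q\<close> real or \<open>Y\<close> negative,
  \<open>Z\<close> is in the lower half-plane, and values greater than \<open>1\<close> are not taken in the upper
  half-plane while \<open>|argY| < \<pi>\<close>.\<close>

lemma U_limit_cases:
  assumes x: "\<And>n. x n \<in> U" and lim: "x \<longlonglongrightarrow> l" and Zlim: "(\<lambda>n. Z (x n)) \<longlonglongrightarrow> \<zeta>"
    and zeta: "Im \<zeta> > 0 \<or> (Im \<zeta> = 0 \<and> Re \<zeta> > 1)"
  shows "Z l = \<zeta> \<and> (if Im \<zeta> > 0 then l \<in> U else Im l = 0 \<and> Re l > 1)"
proof -
  have xU: "Im (x n) > 0" "Im (Q (x n)) > 0" "\<bar>argY (x n)\<bar> < pi" for n using x by (auto simp: U_def)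
  have z01: "\<zeta> \<noteq> 0" "\<zeta> \<noteq> 1" using zeta by auto
  have Iml: "Im l \<ge> 0"
    using xU(1) by (intro LIMSEQ_le_const[OF tendsto_Im[OF lim]]) (auto intro: less_imp_le)
  have not_real: "l \<noteq> of_real c" if "(Z \<longlongrightarrow> 1) (at (of_real c))" for c
  proof
    assume "l = of_real c"
    moreover have "x n \<noteq> of_real c" for n using xU(1)[of n] by auto
    ultimately have "filterlim x (at (of_real c)) sequentially"
      using lim by (auto simp: filterlim_at)
    from filterlim_compose[OF that this] have "\<zeta> = 1" using LIMSEQ_unique[OF Zlim] by blast
    thus False using z01 by simp
  qed
  have l0: "l \<noteq> 0" and l1: "l \<noteq> 1"
    using not_real[of 0] not_real[of 1] Z_tendsto_at_0 Z_tendsto_at_1 by auto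
  have Zl: "Z l = \<zeta>" if "l \<in> dom_Z"
    using LIMSEQ_unique[OF Zlim isCont_tendsto_compose[OF isCont_Z[OF that] lim]] by simp
  show ?thesis
  proof (cases "Im l = 0")
    case True
    define t where "t = Re l"
    have lt: "l = of_real t" using True by (simp add: t_def complex_eq_iff)
    hence t: "t \<noteq> 0" "t \<noteq> 1" using l0 l1 by auto
    have Ql: "(\<lambda>n. Im (Q (x n))) \<longlonglongrightarrow> Im (Q l)"
      by (intro tendsto_Im isCont_tendsto_compose[OF isCont_Q lim]) (use t lt in auto)
    have "Im (Q l) \<ge> 0"
      using xU(2) by (intro LIMSEQ_le_const[OF Ql]) (auto intro: less_imp_le)
    hence tpos: "t > 0" using Im_Q_neg_on_negative_axis[of t] t lt by fastforce
    hence "Z l = \<zeta>" using Zl of_real_in_dom_Z t lt by simp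
    hence zt: "\<zeta> = of_real ((t - 1) / (y t - 1))" using lt Z_of_real tpos by simp
    hence "(t - 1) / (y t - 1) > 1" using zeta by auto
    hence "t > 1" using Z_of_real_less_1[of t] tpos t by fastforce
    thus ?thesis using \<open>Z l = \<zeta>\<close> zt lt zeta by auto
  next
    case False
    hence I: "Im l > 0" using Iml by simp
    have Ql: "(\<lambda>n. Q (x n)) \<longlonglongrightarrow> Q l"
      using I by (intro isCont_tendsto_compose[OF isCont_Q lim]) auto
    have ImQ: "Im (Q l) \<ge> 0"
      using xU(2) by (intro LIMSEQ_le_const[OF tendsto_Im[OF Ql]]) (auto intro: less_imp_le)
    have Q0: "Q l \<noteq> 0"
    proof
      assume "Q l = 0"
      moreover have "Q (x n) \<noteq> 0" for n using xU(2)[of n] by auto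
      ultimately have "(\<lambda>n. Z (x n)) \<longlonglongrightarrow> 0"
        using Z_tendsto_0_at_root_of_Q[OF I _ lim] by simp
      thus False using LIMSEQ_unique[OF Zlim] z01 by blast
    qed
    hence Qc: "Im (Q l) > 0 \<or> Re (Q l) \<noteq> 0" using ImQ by (auto simp: complex_eq_iff)
    have Yl: "(\<lambda>n. Y (x n)) \<longlonglongrightarrow> Y l"
      using I Qc by (intro isCont_tendsto_compose[OF isCont_Y lim]) auto
    have "(\<lambda>n. \<bar>argY (x n)\<bar>) \<longlonglongrightarrow> \<bar>argY l\<bar>"
      using I Qc by (intro tendsto_rabs isCont_tendsto_compose[OF isCont_argY lim]) auto
    hence arg: "\<bar>argY l\<bar> \<le> pi"
      using xU(3) by (intro LIMSEQ_le_const2) (auto intro: less_imp_le)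
    (* If Y l were 1, then Z (x n) * (Y (x n) - 1) = x n - 1 would tend to 0. *)
    have Y1: "Y l \<noteq> 1"
    proof
      assume "Y l = 1"
      hence "(\<lambda>n. Z (x n) * (Y (x n) - 1)) \<longlonglongrightarrow> \<zeta> * (1 - 1)"
        using Yl by (intro tendsto_intros Zlim) auto
      moreover have "Z (x n) * (Y (x n) - 1) = x n - 1" for n
        using x[of n] U_subset_dom_Z by (auto simp: Z_def dom_Z_def)
      ultimately have "(\<lambda>n. x n - 1) \<longlonglongrightarrow> 0" by simp
      hence "x \<longlonglongrightarrow> 1" using LIM_zero_cancel by blast
      thus False using LIMSEQ_unique[OF lim] l1 by blast
    qed
    have l_dom: "l \<in> dom_Z" using I Qc Y1 by (simp add: dom_Z_def)
    have "\<bar>argY l\<bar> \<noteq> pi"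
    proof
      assume "\<bar>argY l\<bar> = pi"
      hence "argY l = pi \<or> argY l = - pi" by linarith
      hence "cis (argY l) = -1" by (auto simp: complex_eq_iff)
      define \<rho> where "\<rho> = cmod l powr (1 + \<alpha>) / cmod (Q l) powr \<alpha>"
      have "\<rho> \<ge> 0" by (simp add: \<rho>_def)
      have "Y l - 1 = of_real (- (\<rho> + 1))"
        using Y_polar[OF l0 Q0] \<open>cis (argY l) = -1\<close> by (simp add: \<rho>_def)
      hence "Im (Z l) = Im l / (- (\<rho> + 1))"
        unfolding Z_def by (simp only: Im_divide_of_real) simp
      hence "Im (Z l) < 0" using I \<open>\<rho> \<ge> 0\<close> by (simp add: divide_pos_neg)
      thus False using Zl[OF l_dom] zeta by simp
    qed
    hence arg: "\<bar>argY l\<bar> < pi" using arg by simp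
    have Imz: "Im \<zeta> > 0"
      using Z_not_real_gt_1[OF I Q0 arg] Zl[OF l_dom] zeta by blast
    moreover have "Im (Q l) \<noteq> 0"
      using Im_Z_neg_on_critical_curve[OF I _ Q0 arg] Zl[OF l_dom] Imz by auto
    ultimately show ?thesis using I ImQ arg Zl[OF l_dom] by (auto simp: U_def)
  qed
qed

lemma U_convergent_subsequence:
  assumes x: "\<And>n. x n \<in> U" and Zlim: "(\<lambda>n. Z (x n)) \<longlonglongrightarrow> \<zeta>"
    and zeta: "Im \<zeta> > 0 \<or> (Im \<zeta> = 0 \<and> Re \<zeta> > 1)"
  obtains r l where "strict_mono r" "(x \<circ> r) \<longlonglongrightarrow> l" "Z l = \<zeta>"
    "if Im \<zeta> > 0 then l \<in> U else Im l = 0 \<and> Re l > 1"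
proof -
  have "Bseq (\<lambda>n. Z (x n))" using Zlim convergentI convergent_imp_Bseq by blast
  then obtain K where "\<And>n. cmod (Z (x n)) \<le> K" by (auto simp: Bseq_def)
  hence "bounded (range x)"
    using bounded_if_Z_bounded[of x K] x by (intro boundedI[where B = "max 4 (K * (2 powr \<alpha> + 1) + 1)"]) auto
  then obtain l r where r: "strict_mono r" "(x \<circ> r) \<longlonglongrightarrow> l"
    using bounded_imp_convergent_subsequence by blast
  have "(\<lambda>n. Z ((x \<circ> r) n)) \<longlonglongrightarrow> \<zeta>"
    using LIMSEQ_subseq_LIMSEQ[OF Zlim r(1)] by (simp add: o_def)
  from U_limit_cases[OF _ r(2) this zeta] x that[OF r] show thesis by auto
qed

lemma eventually_in_U_above_real_point:
  assumes t: "t > 1"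
  shows "eventually (\<lambda>e. Complex t e \<in> U) (at_right 0)"
proof -
  have C0: "Complex t 0 = of_real t" by (simp add: complex_eq_iff)
  obtain D where D: "D > 0" "(Z has_field_derivative of_real D) (at (of_real t))"
    using Z_deriv_real_pos[OF t] .
  have Z: "eventually (\<lambda>e. Im (Z (Complex t e)) > 0) (at_right 0)"
    using t by (intro Im_pos_above_real_point[OF D(2,1)]) (simp add: Z_of_real)
  have "(Q has_field_derivative of_real (t powr b * (b * (t - 1) / t + 1))) (at (of_real t))"
    using Q_has_field_derivative[of "of_real t"] t by (simp add: dQ_of_real)
  moreover have "t powr b * (b * (t - 1) / t + 1) > 0"
    using t b by (intro mult_pos_pos add_nonneg_pos) auto
  ultimately have Q: "eventually (\<lambda>e. Im (Q (Complex t e)) > 0) (at_right 0)"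
    using t by (intro Im_pos_above_real_point) (simp_all add: Q_of_real)
  have "argY (of_real t) = 0" using t q_pos[of t] by (simp add: argY_def Q_of_real lg_of_real)
  moreover have "isCont argY (of_real t)"
    using t q_pos[of t] by (intro isCont_argY) (auto simp: Q_of_real)
  moreover have "((\<lambda>e. Complex t e) \<longlongrightarrow> of_real t) (at_right 0)"
    unfolding C0[symmetric] by (intro tendsto_intros)
  ultimately have "((\<lambda>e. argY (Complex t e)) \<longlongrightarrow> 0) (at_right 0)"
    using isCont_tendsto_compose by fastforce
  hence "((\<lambda>e. \<bar>argY (Complex t e)\<bar>) \<longlongrightarrow> \<bar>0\<bar>) (at_right 0)" by (rule tendsto_rabs)
  hence "eventually (\<lambda>e. \<bar>argY (Complex t e)\<bar> < pi) (at_right 0)"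
    by (rule order_tendstoD) auto
  moreover have "eventually (\<lambda>e::real. e > 0) (at_right 0)" by (simp add: eventually_at_right_less)
  ultimately show ?thesis using Z Q by eventually_elim (auto simp: U_def)
qed

text \<open>The value of \<open>Z\<close> at a point slightly above \<open>2\<close> serves. If such values had second preimages in
  \<open>U\<close>, these would accumulate at a real point with the same value as \<open>2\<close>, hence at \<open>2\<close>
  itself, near which \<open>Z\<close> is injective.\<close>

lemma exists_simple_value:
  obtains z0 where "z0 \<in> U" "deriv Z z0 \<noteq> 0" "\<And>z. z \<in> U \<Longrightarrow> Z z = Z z0 \<Longrightarrow> z = z0"
proof -
  define c where "c = (complex_of_real 2)"
  have c_dom: "c \<in> dom_Z" unfolding c_def by (rule of_real_in_dom_Z) auto
  obtain D where D: "D > 0" "(Z has_field_derivative of_real D) (at c)"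
    unfolding c_def using Z_deriv_real_pos[of 2] by auto
  hence "deriv Z c \<noteq> 0" by (auto dest: DERIV_imp_deriv)
  then obtain \<rho> where rho: "\<rho> > 0" "ball c \<rho> \<subseteq> dom_Z" "inj_on Z (ball c \<rho>)"
    using has_complex_derivative_locally_injective[OF holomorphic_Z c_dom open_dom_Z] by blast
  have reg: "deriv Z z \<noteq> 0" if "z \<in> ball c \<rho>" for z
    using holomorphic_injective_imp_regular[OF holomorphic_on_subset[OF holomorphic_Z rho(2)] open_ball rho(3) that] .
  define x where "x = (\<lambda>n. Complex 2 (inverse (of_nat (Suc n))))"
  have inv0: "filterlim (\<lambda>n. inverse (of_nat (Suc n)) :: real) (at_right 0) sequentially"
    unfolding filterlim_at using LIMSEQ_inverse_real_of_nat by (auto intro!: always_eventually)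
  have xU: "eventually (\<lambda>n. x n \<in> U) sequentially"
    unfolding x_def
    using filterlim_iff[THEN iffD1, OF inv0, rule_format, OF eventually_in_U_above_real_point[of 2]] by simp
  have "x \<longlonglongrightarrow> Complex 2 0"
    unfolding x_def by (intro tendsto_intros LIMSEQ_inverse_real_of_nat)
  moreover have "Complex 2 0 = c" by (simp add: c_def complex_eq_iff)
  ultimately have xc: "x \<longlonglongrightarrow> c" by simp
  hence "eventually (\<lambda>n. x n \<in> ball c \<rho>) sequentially"
    using rho(1) by (intro topological_tendstoD[OF xc]) auto
  with xU have "eventually (\<lambda>n. x n \<in> U \<inter> ball c \<rho>) sequentially" by eventually_elim auto
  then obtain N where N: "\<And>n. n \<ge> N \<Longrightarrow> x n \<in> U \<inter> ball c \<rho>" by (auto simp: eventually_sequentially)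
  have "\<exists>n\<ge>N. \<forall>z\<in>U. Z z = Z (x n) \<longrightarrow> z = x n"
  proof (rule ccontr)
    assume "\<not> ?thesis"
    hence "\<forall>n. \<exists>z\<in>U. Z z = Z (x (n + N)) \<and> z \<noteq> x (n + N)" by (meson le_add2)
    then obtain w where w: "\<And>n. w n \<in> U" "\<And>n. Z (w n) = Z (x (n + N))" "\<And>n. w n \<noteq> x (n + N)"
      by metis
    have wball: "w n \<notin> ball c \<rho>" for n
      using w(2,3)[of n] N[of "n + N"] inj_onD[OF rho(3), of "w n" "x (n + N)"] by auto
    have Zc: "Z c = of_real ((2 - 1) / (y 2 - 1))" unfolding c_def by (rule Z_of_real) simp
    have "(\<lambda>n. Z (x n)) \<longlonglongrightarrow> Z c" using isCont_tendsto_compose[OF isCont_Z[OF c_dom] xc] .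
    hence lim: "(\<lambda>n. Z (w n)) \<longlonglongrightarrow> Z c" unfolding w(2) by (rule LIMSEQ_ignore_initial_segment)
    have real: "Im (Z c) = 0" "Re (Z c) > 1" using Z_of_real_gt_1[of 2] by (simp_all add: Zc)
    obtain r l where "strict_mono r" and l: "(w \<circ> r) \<longlonglongrightarrow> l" "Z l = Z c"
      and l3: "if Im (Z c) > 0 then l \<in> U else Im l = 0 \<and> Re l > 1"
      by (rule U_convergent_subsequence[OF w(1) lim]) (use real in auto)
    from l3 real have l3: "Im l = 0" "Re l > 1" by simp_all
    have "l = of_real (Re l)" using l3 by (simp add: complex_eq_iff)
    hence "Re l = 2" using l(2) l3(2) Z_inj_on_real[of "Re l" 2] by (simp add: c_def)
    hence "l = c" using \<open>l = of_real (Re l)\<close> by (simp add: c_def)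
    hence "eventually (\<lambda>n. (w \<circ> r) n \<in> ball c \<rho>) sequentially"
      using rho(1) l(1) topological_tendstoD[OF _ open_ball, of "w \<circ> r" c] by simp
    thus False using wball by (auto simp: eventually_sequentially)
  qed
  then obtain n where "n \<ge> N" "\<And>z. z \<in> U \<Longrightarrow> Z z = Z (x n) \<Longrightarrow> z = x n" by blast
  thus thesis using that[of "x n"] N[of n] reg[of "x n"] by blast
qed

lemma bij_betw_Z: "bij_betw Z U upper_half_plane"
proof -
  obtain z0 where z0: "z0 \<in> U" "deriv Z z0 \<noteq> 0" "\<And>z. z \<in> U \<Longrightarrow> Z z = Z z0 \<Longrightarrow> z = z0"
    using exists_simple_value by blast
  show ?thesis
  proof (rule proper_holomorphic_bij_betw[where ?z0.0 = z0])
    show "open upper_half_plane" "connected upper_half_plane"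
      by (auto simp: upper_half_plane_def open_halfspace_Im_gt convex_halfspace_Im_gt convex_connected)
    show "Z holomorphic_on U" using holomorphic_Z U_subset_dom_Z by (rule holomorphic_on_subset)
    show "Z ` U \<subseteq> upper_half_plane" by (auto simp: upper_half_plane_def U_def)
    fix x \<zeta> assume x: "\<And>n::nat. x n \<in> U" "(\<lambda>n. Z (x n)) \<longlonglongrightarrow> \<zeta>" "\<zeta> \<in> upper_half_plane"
    hence "Im \<zeta> > 0" by (simp add: upper_half_plane_def)
    thus "\<exists>u\<in>U. \<exists>r. strict_mono r \<and> (x \<circ> r) \<longlonglongrightarrow> u"
      by (metis U_convergent_subsequence[OF x(1,2)])
  qed (use z0 open_U in auto)
qed

section \<open>The inverse of Z and its boundary values\<close>

text \<open>Preimages of \<open>c + i/(n + 1)\<close> in \<open>U\<close> accumulate at a suitable real point.\<close>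

lemma ex_real_preimage:
  assumes c: "c > 1"
  shows "\<exists>t>1. Z (of_real t) = of_real c"
proof -
  define \<zeta> where "\<zeta> = (\<lambda>n. Complex c (inverse (of_nat (Suc n))))"
  have "\<zeta> n \<in> Z ` U" for n
    using bij_betw_imp_surj_on[OF bij_betw_Z] by (simp add: \<zeta>_def upper_half_plane_def)
  hence "\<forall>n. \<exists>x\<in>U. Z x = \<zeta> n" by (metis imageE)
  then obtain x where x: "\<And>n. x n \<in> U" "\<And>n. Z (x n) = \<zeta> n" by metis
  have "\<zeta> \<longlonglongrightarrow> Complex c 0"
    unfolding \<zeta>_def by (intro tendsto_intros LIMSEQ_inverse_real_of_nat)
  hence lim: "(\<lambda>n. Z (x n)) \<longlonglongrightarrow> Complex c 0" using x(2) by simp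
  obtain r l where "strict_mono r" "(x \<circ> r) \<longlonglongrightarrow> l" "Z l = Complex c 0"
    "if Im (Complex c 0) > 0 then l \<in> U else Im l = 0 \<and> Re l > 1"
    by (rule U_convergent_subsequence[OF x(1) lim]) (use c in auto)
  moreover from this(4) have "l = of_real (Re l)" by (simp add: complex_eq_iff)
  moreover have "Complex c 0 = of_real c" by (simp add: complex_eq_iff)
  ultimately show ?thesis by (intro exI[of _ "Re l"]) simp
qed

definition real_inv :: "real \<Rightarrow> real" where
  "real_inv c = (SOME t. t > 1 \<and> Z (of_real t) = of_real c)"

lemma real_inv: "c > 1 \<Longrightarrow> real_inv c > 1" "c > 1 \<Longrightarrow> Z (of_real (real_inv c)) = of_real c"
  unfolding real_inv_def using someI_ex[OF ex_real_preimage[of c, unfolded Bex_def]] by auto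

lemma real_inv_Z:
  assumes t: "t > 1" and c: "Z (of_real t) = of_real c"
  shows "real_inv c = t"
proof -
  have "(t - 1) / (y t - 1) = c" using t c Z_of_real[of t] by (simp only: of_real_eq_iff)
  hence "c > 1" using Z_of_real_gt_1[OF t] by simp
  thus ?thesis using Z_inj_on_real[OF real_inv(1) t] real_inv(2) c by simp
qed

lemma real_inv_less: "c > 1 \<Longrightarrow> t > 1 \<Longrightarrow> c < Re (Z (of_real t)) \<Longrightarrow> real_inv c < t"
  using real_inv[of c] Z_of_real_strict_mono[of t "real_inv c"]
  by (cases "real_inv c" t rule: linorder_cases) auto

lemma real_inv_greater: "c > 1 \<Longrightarrow> t > 1 \<Longrightarrow> Re (Z (of_real t)) < c \<Longrightarrow> t < real_inv c"
  using real_inv[of c] Z_of_real_strict_mono[of "real_inv c" t]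
  by (cases "real_inv c" t rule: linorder_cases) auto

lemma isCont_real_inv:
  assumes c: "c > 1"
  shows "isCont real_inv c"
  unfolding isCont_def
proof (rule order_tendstoI)
  note r = real_inv[OF c]
  have gt1: "eventually (\<lambda>s. s > 1) (at c)"
    using c by (intro order_tendstoD(1)[OF tendsto_ident_at]) auto
  {
    fix a assume a: "a < real_inv c"
    (* Z is monotone on (1, infinity) only, and a may lie outside. *)
    define a' where "a' = max a ((1 + real_inv c) / 2)"
    have a': "1 < a'" "a' < real_inv c" "a \<le> a'" using a r(1) by (simp_all add: a'_def less_max_iff_disj)
    have "Re (Z (of_real a')) < c" using Z_of_real_strict_mono[OF a'(1,2)] r by simp
    hence "eventually (\<lambda>s. Re (Z (of_real a')) < s) (at c)"
      by (intro order_tendstoD(1)[OF tendsto_ident_at])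
    thus "eventually (\<lambda>s. a < real_inv s) (at c)"
      using gt1 by eventually_elim (use a' real_inv_greater in fastforce)
  next
    fix a assume a: "a > real_inv c"
    have "c < Re (Z (of_real a))" using Z_of_real_strict_mono[OF r(1) a] r by simp
    hence "eventually (\<lambda>s. s < Re (Z (of_real a))) (at c)"
      by (intro order_tendstoD(2)[OF tendsto_ident_at])
    thus "eventually (\<lambda>s. real_inv s < a) (at c)"
      using gt1 by eventually_elim (use a r real_inv_less in auto)
  }
qed

lemma real_inv_tendsto_1: "(real_inv \<longlongrightarrow> 1) (at_right 1)"
proof (rule order_tendstoI)
  have gt1: "eventually (\<lambda>s::real. s > 1) (at_right 1)" by (simp add: eventually_at_right_less)
  {
    fix a :: real assume "a < 1"
    thus "eventually (\<lambda>s. a < real_inv s) (at_right 1)"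
      using gt1 by (auto elim!: eventually_mono dest: real_inv(1))
  next
    fix a :: real assume a: "a > 1"
    have "eventually (\<lambda>s. s < Re (Z (of_real a))) (at_right 1)"
      by (rule order_tendstoD(2)[OF tendsto_ident_at Re_Z_of_real_gt_1[OF a]])
    thus "eventually (\<lambda>s. real_inv s < a) (at_right 1)"
      using gt1 by eventually_elim (use a real_inv_less in auto)
  }
qed

definition Zinv :: "complex \<Rightarrow> complex" where
  "Zinv \<zeta> = (if Im \<zeta> > 0 then inv_into U Z \<zeta> else of_real (real_inv (Re \<zeta>)))"

lemma Zinv_in_U: "Im \<zeta> > 0 \<Longrightarrow> Zinv \<zeta> \<in> U" "Im \<zeta> > 0 \<Longrightarrow> Z (Zinv \<zeta>) = \<zeta>"
  using bij_betw_imp_surj_on[OF bij_betw_Z] inv_into_into[of \<zeta> Z U] f_inv_into_f[of \<zeta> Z U]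
  by (auto simp: Zinv_def upper_half_plane_def)

lemma holomorphic_Zinv: "Zinv holomorphic_on {\<zeta>. Im \<zeta> > 0}"
proof -
  have ZU: "Z ` U = {\<zeta>. Im \<zeta> > 0}" "inj_on Z U"
    using bij_betw_Z by (auto simp: bij_betw_def upper_half_plane_def)
  obtain g where g: "g holomorphic_on (Z ` U)" "\<And>z. z \<in> U \<Longrightarrow> g (Z z) = z"
    using holomorphic_has_inverse[OF holomorphic_on_subset[OF holomorphic_Z U_subset_dom_Z] open_U ZU(2)] by metis
  have "g \<zeta> = Zinv \<zeta>" if "Im \<zeta> > 0" for \<zeta>
    using g(2)[OF Zinv_in_U(1)[OF that]] Zinv_in_U(2)[OF that] by simp
  thus ?thesis using g(1) unfolding ZU(1) by (auto intro: holomorphic_transform)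
qed

text \<open>By compactness a sequence of preimages of values tending to \<open>c\<close> accumulates at real preimages of
  \<open>c\<close> only, and there is just one of these.\<close>

lemma Zinv_tendsto_real:
  assumes c: "c > 1"
  shows "(Zinv \<longlongrightarrow> of_real (real_inv c)) (at (of_real c) within {\<zeta>. Im \<zeta> > 0})"
proof (rule ccontr)
  assume "\<not> ?thesis"
  then obtain e where e: "e > 0"
    and far: "\<And>d. d > 0 \<Longrightarrow> \<exists>\<zeta>. Im \<zeta> > 0 \<and> dist \<zeta> (of_real c) < d \<and> dist (Zinv \<zeta>) (of_real (real_inv c)) \<ge> e"
    unfolding Lim_within by (force simp: not_less)
  have "\<forall>n. \<exists>\<zeta>. Im \<zeta> > 0 \<and> dist \<zeta> (of_real c) < inverse (of_nat (Suc n)) \<and> dist (Zinv \<zeta>) (of_real (real_inv c)) \<ge> e"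
    using far by (auto simp del: of_nat_Suc)
  then obtain \<zeta> where z: "\<And>n. Im (\<zeta> n) > 0" "\<And>n. dist (\<zeta> n) (of_real c) < inverse (of_nat (Suc n))"
    "\<And>n. dist (Zinv (\<zeta> n)) (of_real (real_inv c)) \<ge> e" by metis
  have "(\<lambda>n. dist (\<zeta> n) (of_real c)) \<longlonglongrightarrow> 0"
    by (rule tendsto_sandwich[OF _ _ tendsto_const LIMSEQ_inverse_real_of_nat])
      (use z(2) in \<open>auto intro!: always_eventually less_imp_le simp del: of_nat_Suc\<close>)
  hence "\<zeta> \<longlonglongrightarrow> of_real c" by (rule tendsto_dist_iff[THEN iffD2])
  hence lim: "(\<lambda>n. Z (Zinv (\<zeta> n))) \<longlonglongrightarrow> of_real c" using z(1) Zinv_in_U(2) by simp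
  have inU: "Zinv (\<zeta> n) \<in> U" for n using z(1) Zinv_in_U(1) by simp
  obtain r l where r: "strict_mono r" "((\<lambda>n. Zinv (\<zeta> n)) \<circ> r) \<longlonglongrightarrow> l" "Z l = of_real c"
    "if Im (complex_of_real c) > 0 then l \<in> U else Im l = 0 \<and> Re l > 1"
    by (rule U_convergent_subsequence[OF inU lim]) (use c in auto)
  have lr: "l = of_real (Re l)" "Re l > 1" using r(4) by (simp_all add: complex_eq_iff)
  have "real_inv c = Re l" using real_inv_Z[OF lr(2)] r(3) lr(1) by simp
  hence "((\<lambda>n. Zinv (\<zeta> n)) \<circ> r) \<longlonglongrightarrow> of_real (real_inv c)" using r(2) lr(1) by simp
  hence "eventually (\<lambda>n. dist (((\<lambda>n. Zinv (\<zeta> n)) \<circ> r) n) (of_real (real_inv c)) < e) sequentially"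
    using e by (rule tendstoD)
  thus False using z(3) by (auto simp: eventually_sequentially not_less[symmetric])
qed

lemma continuous_on_Zinv: "continuous_on ({\<zeta>. Im \<zeta> > 0} \<union> of_real ` {1<..}) Zinv"
  unfolding continuous_on_def
proof
  fix \<zeta> :: complex assume "\<zeta> \<in> {\<zeta>. Im \<zeta> > 0} \<union> of_real ` {1<..}"
  then consider "Im \<zeta> > 0" | c where "c > 1" "\<zeta> = of_real c" by auto
  thus "(Zinv \<longlongrightarrow> Zinv \<zeta>) (at \<zeta> within {\<zeta>. Im \<zeta> > 0} \<union> of_real ` {1<..})"
  proof cases
    case 1
    have "isCont Zinv \<zeta>"
      using holomorphic_on_imp_continuous_on[OF holomorphic_Zinv] open_halfspace_Im_gt 1
      by (metis continuous_on_eq_continuous_at mem_Collect_eq)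
    thus ?thesis unfolding isCont_def by (rule tendsto_within_subset) simp
  next
    case (2 c)
    have val: "Zinv \<zeta> = of_real (real_inv c)" using 2 by (simp add: Zinv_def)
    have "(Zinv \<longlongrightarrow> of_real (real_inv c)) (at \<zeta> within of_real ` {1<..})"
      unfolding Lim_within
    proof (intro allI impI)
      fix e :: real assume e: "e > 0"
      then obtain d where d: "d > 0" "\<And>s. s \<noteq> c \<Longrightarrow> dist s c < d \<Longrightarrow> dist (real_inv s) (real_inv c) < e"
        using tendstoD[OF isCont_real_inv[OF 2(1), unfolded isCont_def] e] unfolding eventually_at by auto
      show "\<exists>d>0. \<forall>x\<in>of_real ` {1<..}. 0 < dist x \<zeta> \<and> dist x \<zeta> < d \<longrightarrow> dist (Zinv x) (of_real (real_inv c)) < e"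
        using d by (intro exI[of _ d]) (auto simp: 2 Zinv_def)
    qed
    thus ?thesis unfolding val using Zinv_tendsto_real[OF 2(1)] 2 by (auto simp: Lim_within_Un)
  qed
qed

section \<open>The Pick function\<close>

text \<open>The function \<open>Q \<circ> Z\<^sup>-\<^sup>1\<close> with its reflection. The value at \<open>1\<close> is set by hand, because
  on the real axis \<open>Zinv\<close> is meaningful only beyond \<open>1\<close>.\<close>

definition pick :: "complex \<Rightarrow> complex" where
  "pick z = (if z = 1 then 1 else if 0 \<le> Im z then Q (Zinv z) else cnj (Q (Zinv (cnj z))))"

lemma pick_of_real: "c > 1 \<Longrightarrow> pick (of_real c) = of_real (q (real_inv c))"
  using real_inv(1)[of c] by (simp add: pick_def Zinv_def Q_of_real)

end

lemma reflected_domain_eq: "reflected_domain = {z. Im z > 0} \<union> {z. Im z < 0} \<union> {z. Re z > 1}"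
proof (intro equalityI subsetI)
  fix z assume "z \<in> {z. Im z > 0} \<union> {z. Im z < 0} \<union> {z. Re z > 1}"
  then consider "Im z > 0" | "Im z < 0" | "Im z = 0" "Re z > 1" by force
  thus "z \<in> reflected_domain"
  proof cases
    case 2
    hence "z = cnj (cnj z)" "cnj z \<in> upper_half_plane" by (auto simp: upper_half_plane_def)
    thus ?thesis unfolding reflected_domain_def by blast
  next
    case 3
    hence "z = of_real (Re z)" by (simp add: complex_eq_iff)
    thus ?thesis using 3 unfolding reflected_domain_def by blast
  qed (auto simp: reflected_domain_def upper_half_plane_def)
qed (auto simp: reflected_domain_def upper_half_plane_def)

lemma open_reflected_domain: "open reflected_domain"
  unfolding reflected_domain_eq
  by (intro open_Un open_halfspace_Im_gt open_halfspace_Im_lt open_halfspace_Re_gt)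

context exponent begin

lemma pick_in_PAL: "pick \<in> PAL"
proof -
  have upper: "reflected_domain \<inter> {z. 0 < Im z} = {z. 0 < Im z}"
    and closed_upper: "reflected_domain \<inter> {z. 0 \<le> Im z} = {z. 0 < Im z} \<union> of_real ` {1<..}"
    by (auto simp: reflected_domain_def upper_half_plane_def)
  have one: "1 \<notin> reflected_domain" by (simp add: reflected_domain_eq)
  have Q_hol: "Q holomorphic_on {X. Im X > 0}"
    using Q_has_field_derivative by (subst holomorphic_on_open) (auto simp: open_halfspace_Im_gt)
  have Q_cont: "continuous_on ({X. Im X > 0} \<union> of_real ` {1<..}) Q"
    by (intro continuous_at_imp_continuous_on ballI isCont_Q) auto
  have in_upper: "Im (Zinv z) > 0" "Im (Q (Zinv z)) > 0" if "Im z > 0" for z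
    using Zinv_in_U(1)[OF that] by (auto simp: U_def)
  have "(\<lambda>z. if 0 \<le> Im z then (Q \<circ> Zinv) z else cnj ((Q \<circ> Zinv) (cnj z))) holomorphic_on reflected_domain"
  proof (rule Schwarz_reflection[OF open_reflected_domain])
    show "cnj ` reflected_domain \<subseteq> reflected_domain" by (auto simp: reflected_domain_eq)
    show "(Q \<circ> Zinv) holomorphic_on reflected_domain \<inter> {z. 0 < Im z}"
      unfolding upper by (rule holomorphic_on_compose_gen[OF holomorphic_Zinv Q_hol]) (auto simp: in_upper)
    have img: "Zinv ` ({z. 0 < Im z} \<union> of_real ` {1<..}) \<subseteq> {X. Im X > 0} \<union> of_real ` {1<..}"
      using in_upper(1) real_inv(1) by (auto simp: Zinv_def)
    show "continuous_on (reflected_domain \<inter> {z. 0 \<le> Im z}) (Q \<circ> Zinv)"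
      unfolding closed_upper
      by (rule continuous_on_compose[OF continuous_on_Zinv continuous_on_subset[OF Q_cont img]])
    fix z assume z: "z \<in> reflected_domain" "z \<in> \<real>"
    then obtain c where c: "z = of_real c" by (auto elim: Reals_cases)
    hence "c > 1" using z by (simp add: reflected_domain_eq)
    thus "(Q \<circ> Zinv) z \<in> \<real>" using real_inv(1)[of c] by (simp add: c Zinv_def Q_of_real)
  qed
  hence hol: "pick holomorphic_on reflected_domain"
    by (rule holomorphic_transform) (use one in \<open>auto simp: pick_def\<close>)
  have sym: "pick (cnj z) = cnj (pick z)" if z: "z \<in> reflected_domain" for z
  proof -
    have ne: "z \<noteq> 1" "cnj z \<noteq> 1" using z one by auto
    consider "Im z > 0" | "Im z < 0" | c where "z = of_real c" "c > 1"
      using z by (auto simp: reflected_domain_def upper_half_plane_def)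
    thus ?thesis
    proof cases
      case (3 c)
      thus ?thesis by (simp add: pick_of_real)
    qed (use ne in \<open>simp_all add: pick_def\<close>)
  qed
  have "isCont q 1" unfolding q_def[abs_def] by (intro continuous_intros) simp_all
  hence "((\<lambda>c. q (real_inv c)) \<longlongrightarrow> q 1) (at_right 1)"
    by (rule isCont_tendsto_compose[OF _ real_inv_tendsto_1])
  hence "((\<lambda>c. complex_of_real (q (real_inv c))) \<longlongrightarrow> of_real (q 1)) (at_right 1)" by (rule tendsto_of_real)
  hence "((\<lambda>c. complex_of_real (q (real_inv c))) \<longlongrightarrow> 1) (at_right 1)" by (simp add: q_def)
  moreover have "eventually (\<lambda>c. complex_of_real (q (real_inv c)) = pick (of_real c)) (at_right 1)"
    unfolding eventually_at_right_field by (intro exI[of _ 2]) (auto simp: pick_of_real)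
  ultimately have lim: "((\<lambda>c. pick (of_real c)) \<longlongrightarrow> 1) (at_right 1)" by (rule Lim_transform_eventually)
  show ?thesis unfolding PAL_def mem_Collect_eq
  proof (intro conjI ballI allI impI)
    fix z assume "z \<in> upper_half_plane"
    thus "Im (pick z) > 0" using in_upper(2)[of z] by (auto simp: pick_def upper_half_plane_def)
  next
    show "pick analytic_on reflected_domain" using hol open_reflected_domain by (simp add: analytic_on_open)
  next
    fix x :: real assume "x > 1"
    thus "pick (of_real x) \<in> \<real>" by (simp add: pick_of_real)
  qed (use sym lim in \<open>auto simp: pick_def\<close>)
qed

text \<open>After division by \<open>a\<close> the orbit is \<open>0, 1, u, w, 1 - t w^\<alpha>\<close> with \<open>t = a^(\<alpha>-1)\<close>, \<open>u = 1 - t\<close> and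
  \<open>w = 1 - t u^\<alpha>\<close>. The parameter \<open>X = u^(-\<alpha>)\<close> is chosen such that \<open>y X = w^(-\<alpha>)\<close>.\<close>

lemma pr_eq:
  assumes a: "0 < a" "a < 1"
  defines "X \<equiv> (1 - a powr (\<alpha> - 1)) powr (- \<alpha>)"
  shows "X > 1" and "pr \<alpha> 3 a = q X" and "pr \<alpha> 4 a = (X - 1) / (y X - 1)"
proof -
  define t u w where "t = a powr (\<alpha> - 1)" and "u = 1 - t" and "w = 1 - t * u powr \<alpha>"
  have "a powr (\<alpha> - 1) < 1 powr (\<alpha> - 1)" using a alpha by (intro powr_less_mono2) auto
  hence t: "0 < t" "t < 1" using a by (auto simp: t_def)
  hence u: "0 < u" "u < 1" by (auto simp: u_def)
  have Xu: "X = u powr (- \<alpha>)" by (simp add: X_def u_def t_def)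
  have ua: "0 < u powr \<alpha>" "u powr \<alpha> < 1"
    using u powr_less_mono2[of \<alpha> u 1] alpha by auto
  have w: "0 < w" "w < 1"
    using ua t mult_strict_mono[of t 1 "u powr \<alpha>" 1] by (auto simp: w_def)
  have wa: "0 < w powr \<alpha>" "w powr \<alpha> < 1"
    using w powr_less_mono2[of \<alpha> w 1] alpha by auto
  have X: "X = 1 / u powr \<alpha>" by (simp add: Xu powr_minus_divide)
  thus X1: "X > 1" using ua by simp
  have ta: "a powr \<alpha> = a * t"
    using a by (simp add: t_def powr_diff)
  have orb: "orb \<alpha> a 0 = 0" "orb \<alpha> a 1 = a" "orb \<alpha> a 2 = a * u"
    "orb \<alpha> a 3 = a * w" "orb \<alpha> a 4 = a * (1 - t * w powr \<alpha>)"
  proof -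
    have step: "fmap \<alpha> a (a * s) = a * (1 - t * s powr \<alpha>)" if "s > 0" for s
      using a that by (simp add: fmap_def abs_mult powr_mult ta algebra_simps)
    have o: "orb \<alpha> a (Suc n) = fmap \<alpha> a (orb \<alpha> a n)" for n by (simp add: orb_def)
    show o0: "orb \<alpha> a 0 = 0" by (simp add: orb_def)
    show o1: "orb \<alpha> a 1 = a" using o[of 0] o0 by (simp add: fmap_def)
    show o2: "orb \<alpha> a 2 = a * u" using o[of 1] o1 step[of 1] by (simp add: u_def numeral_2_eq_2)
    show o3: "orb \<alpha> a 3 = a * w" using o[of 2] o2 step[OF u(1)] by (simp add: w_def numeral_3_eq_3 numeral_2_eq_2)
    show "orb \<alpha> a 4 = a * (1 - t * w powr \<alpha>)"
      using o[of 3] o3 step[OF w(1)] by (simp add: eval_nat_numeral)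
  qed
  have w_diff: "w - u = t * (1 - u powr \<alpha>)" by (simp add: w_def u_def algebra_simps)
  have Xb: "X powr b = 1 / u" "X powr (- b) = u"
  proof -
    have "X powr b = u powr (- 1)" "X powr (- b) = u powr 1"
      unfolding Xu powr_powr using b by simp_all
    thus "X powr b = 1 / u" "X powr (- b) = u" using u by (simp_all add: powr_minus_divide)
  qed
  show "pr \<alpha> 3 a = q X"
  proof -
    have "pr \<alpha> 3 a = (0 - a * w) / (0 - a * u) * ((a * u - a) / (a * w - a))"
      using orb by (simp add: pr_def)
    also have "a * u - a = - (a * t)" by (simp add: u_def algebra_simps)
    also have "a * w - a = - (a * t * u powr \<alpha>)" by (simp add: w_def algebra_simps)
    also have "(0 - a * w) / (0 - a * u) * (- (a * t) / - (a * t * u powr \<alpha>)) = w / (u * u powr \<alpha>)"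
      using a t by simp
    also have "\<dots> = q X"
    proof -
      have "w = u * u powr \<alpha> + 1 - u powr \<alpha>" by (simp add: w_def u_def algebra_simps)
      moreover have "q X = 1 + 1 / u * (1 / u powr \<alpha> - 1)" by (simp add: q_def Xb(1)) (simp add: X)
      ultimately show ?thesis using u(1) ua(1) by (simp add: field_simps)
    qed
    finally show ?thesis .
  qed
  have yX: "y X = 1 / w powr \<alpha>"
  proof -
    have "y X powr (- b) = (u + X - 1) / X" using y_powr_neg_b(1)[of X] X1 Xb by simp
    also have "\<dots> = w" using ua by (simp add: X w_def u_def field_simps)
    finally have "(y X powr (- b)) powr (- \<alpha>) = w powr (- \<alpha>)" by simp
    moreover have "(y X powr (- b)) powr (- \<alpha>) = y X"
      unfolding powr_powr using y_pos[of X] X1 b by simp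
    ultimately show ?thesis by (simp only: powr_minus_divide)
  qed
  show "pr \<alpha> 4 a = (X - 1) / (y X - 1)"
  proof -
    have "pr \<alpha> 4 a = (a - a * (1 - t * w powr \<alpha>)) / (a - a * w) * ((a * w - a * u) / (a * (1 - t * w powr \<alpha>) - a * u))"
      using orb by (simp add: pr_def)
    also have "a - a * (1 - t * w powr \<alpha>) = a * t * w powr \<alpha>" by (simp add: algebra_simps)
    also have "a - a * w = a * t * u powr \<alpha>" by (simp add: w_def algebra_simps)
    also have "a * w - a * u = a * t * (1 - u powr \<alpha>)" 
      unfolding right_diff_distrib[symmetric] w_diff by (simp add: mult.assoc)
    also have "a * (1 - t * w powr \<alpha>) - a * u = a * t * (1 - w powr \<alpha>)" by (simp add: u_def algebra_simps)
    also have "a * t * w powr \<alpha> / (a * t * u powr \<alpha>) * (a * t * (1 - u powr \<alpha>) / (a * t * (1 - w powr \<alpha>)))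
       = (w powr \<alpha> / u powr \<alpha>) * ((1 - u powr \<alpha>) / (1 - w powr \<alpha>))"
      using a t by simp
    also have "\<dots> = (X - 1) / (y X - 1)"
    proof -
      have "X - 1 = (1 - u powr \<alpha>) / u powr \<alpha>" "y X - 1 = (1 - w powr \<alpha>) / w powr \<alpha>"
        unfolding yX unfolding X using ua(1) wa(1) by (simp_all add: diff_divide_distrib)
      thus ?thesis by simp
    qed
    finally show ?thesis .
  qed
qed

end

theorem theorem2:
  fixes \<alpha> :: real
  assumes "\<alpha> > 1"
  shows "\<exists>\<phi>\<in>PAL. \<forall>a\<in>{0<..<1}.
           pr \<alpha> 4 a > 1 \<and> \<phi> (complex_of_real (pr \<alpha> 4 a)) = complex_of_real (pr \<alpha> 3 a)"
proof -
  interpret exponent \<alpha> by unfold_locales (rule assms)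
  show ?thesis
  proof (intro bexI[OF _ pick_in_PAL] ballI)
    fix a :: real assume "a \<in> {0<..<1}"
    then obtain X where X: "X > 1" "pr \<alpha> 3 a = q X" "pr \<alpha> 4 a = (X - 1) / (y X - 1)"
      using pr_eq[of a] by auto
    have gt: "pr \<alpha> 4 a > 1" using Z_of_real_gt_1 X by simp
    moreover have "real_inv (pr \<alpha> 4 a) = X" using real_inv_Z[OF X(1)] Z_of_real[of X] X by simp
    ultimately show "pr \<alpha> 4 a > 1 \<and> pick (complex_of_real (pr \<alpha> 4 a)) = complex_of_real (pr \<alpha> 3 a)"
      using pick_of_real[OF gt] X(2) by simp
  qed
qed

end
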